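(* Let $a,b,\epsilon>0$ be real numbers and let $M=\{(x,y,z)\in\mathbb{R}^3 : ax^2+\epsilon x^4+ay^2+\epsilon y^4+bz^2=1\}$. (1) Suppose $a>b$. The number of umbilic points of $M$ is $2$ if $\epsilon\le\frac{a^2}{6}\left(\frac{a}{b}-1\right)$, and $10$ if $\epsilon>\frac{a^2}{6}\left(\frac{a}{b}-1\right)$. (1a) When $\epsilon\le\frac{a^2}{6}\left(\frac{a}{b}-1\right)$, these points occur at $(0,0,\pm\sqrt{1/b})$ and have index $1$. (1b) When $\epsilon>\frac{a^2}{6}\left(\frac{a}{b}-1\right)$, these points occur at $(0,0,\pm\sqrt{1/b})$ and at $(0,\pm\rho,\pm\zeta)$ and $(\pm\rho,0,\pm\zeta)$ (all choices of signs being allowed independently), where $$\rho=\left(\frac{-a+\sqrt{3b(2a+b)^{-1}(a^2+4\epsilon)}}{2\epsilon}\right)^{\frac12},\qquad \zeta=\left(\frac{(a-b)(a^2+4\epsilon)}{2b\epsilon(2a+b)}\right)^{\frac12}.$$ (2) Suppose $a<b$. The number of umbilic points of $M$ is $2$ if $\epsilon<\frac{(5a+b)(b-a)}{18}$, and $18$ if $\epsilon>\frac{(5a+b)(b-a)}{18}$. (2a) When $\epsilon<\frac{(5a+b)(b-a)}{18}$, these points occur at $(0,0,\pm\sqrt{1/b})$ and have index $1$. (2b) When $\epsilon>\frac{(5a+b)(b-a)}{18}$, these points occur at $(0,0,\pm\sqrt{1/b})$ and at (all choices of signs being allowed independently) $$\left(\pm\sqrt{\frac{b-a}{6\epsilon}},\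 \pm\sqrt{\frac{b-a}{6\epsilon}},\ \pm\left(\frac{5a^2-4ab-b^2+18\epsilon}{18b\epsilon}\right)^{\frac12}\right).$$
   Context: A point of a smooth regular surface in $\mathbb{R}^3$ is umbilic if its two principal curvatures there are equal (equivalently, the shape operator at the point is a scalar multiple of the identity). The index of an isolated umbilic point $p$ is the index at $p$ of the principal direction field, i.e. of the (unoriented) line field, defined on a punctured neighborhood of $p$, given by the principal direction of one fixed principal curvature (say the larger one): it is $\frac{1}{2\pi}$ times the total rotation angle of this line field, measured in a positively oriented local chart, along a small simple closed curve traversed once counterclockwise around $p$. It is an element of $\frac12\mathbb{Z}$.
   Formalization: In (2b) the list of points has only 2+8=10 entries, contradicting the count 18 in (2); the formal statement asserts that there are exactly 18 umbilic points and that the listed 10 are among them, instead of that the list is complete. *)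

theory Defs
  imports "HOL-Complex_Analysis.Complex_Analysis"
begin

text \<open>
  The parameter plane of a local parametrization is the complex plane, identified with
  \<open>\<real>\<^sup>2\<close>: a map \<open>X(u, v)\<close> is a function of \<open>u + i v\<close>, its partial derivatives are
  the values of its real derivative at \<open>1\<close> and \<open>\<i>\<close>, a direction of angle \<open>\<theta>\<close> is
  \<open>cis \<theta>\<close>, and \<open>winding_number\<close> applies to loops in the parameter domain.
\<close>

primrec Ck_on :: "nat \<Rightarrow> 'a::euclidean_space set \<Rightarrow> ('a \<Rightarrow> 'b::euclidean_space) \<Rightarrow> bool" where
  "Ck_on 0 U f \<longleftrightarrow> continuous_on U f"
| "Ck_on (Suc n) U f \<longleftrightarrow>
     (\<forall>x\<in>U. f differentiable (at x)) \<and>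
     (\<forall>v. Ck_on n U (\<lambda>x. frechet_derivative f (at x) v))"

definition smooth_on :: "'a::euclidean_space set \<Rightarrow> ('a \<Rightarrow> 'b::euclidean_space) \<Rightarrow> bool" where
  "smooth_on U f \<longleftrightarrow> (\<forall>n. Ck_on n U f)"

definition local_parametrization :: "(real^3) set \<Rightarrow> complex set \<Rightarrow> (complex \<Rightarrow> real^3) \<Rightarrow> bool" where
  "local_parametrization M U X \<longleftrightarrow>
     open U \<and> smooth_on U X \<and>
     (\<forall>u\<in>U. inj (frechet_derivative X (at u))) \<and>
     openin (top_of_set M) (X ` U) \<and>
     (\<exists>Y. homeomorphism U (X ` U) X Y)"

definition tangent_plane :: "(complex \<Rightarrow> real^3) \<Rightarrow> complex \<Rightarrow> (real^3) set" where
  "tangent_plane X u = range (frechet_derivative X (at u))"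

definition unit_normal :: "(complex \<Rightarrow> real^3) \<Rightarrow> complex \<Rightarrow> real^3" where
  "unit_normal X u =
     sgn (cross3 (frechet_derivative X (at u) 1) (frechet_derivative X (at u) \<i>))"

text \<open>
  The shape operator is minus the differential of the Gauss map: a tangent vector
  \<open>w = dX v\<close> is sent to \<open>- dN v\<close>. It is meaningful for \<open>w\<close> in the tangent plane, where
  \<open>v\<close> is unique because \<open>dX\<close> is injective.
\<close>

definition shape_operator :: "(complex \<Rightarrow> real^3) \<Rightarrow> complex \<Rightarrow> real^3 \<Rightarrow> real^3" where
  "shape_operator X u w =
     - frechet_derivative (unit_normal X) (at u) (inv (frechet_derivative X (at u)) w)"

definition principal_vector :: "(complex \<Rightarrow> real^3) \<Rightarrow> complex \<Rightarrow> real \<Rightarrow> real^3 \<Rightarrow> bool" where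
  "principal_vector X u k w \<longleftrightarrow>
     w \<in> tangent_plane X u \<and> w \<noteq> 0 \<and> shape_operator X u w = k *\<^sub>R w"

definition principal_curvature :: "(complex \<Rightarrow> real^3) \<Rightarrow> complex \<Rightarrow> real \<Rightarrow> bool" where
  "principal_curvature X u k \<longleftrightarrow> (\<exists>w. principal_vector X u k w)"

text \<open>
  Reversing the normal only changes the sign of the shape operator, so whether it is a
  multiple of the identity does not depend on the parametrization.
\<close>

definition umbilic_points :: "(real^3) set \<Rightarrow> (real^3) set" where
  "umbilic_points M =
     {p. \<exists>U X u. local_parametrization M U X \<and> u \<in> U \<and> X u = p \<and>
         (\<exists>k. \<forall>w\<in>tangent_plane X u. shape_operator X u w = k *\<^sub>R w)}"

text \<open>
  \<open>major_direction X u v\<close>: the chart vector \<open>v\<close> represents a principal direction for the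
  larger of the two principal curvatures.
\<close>

definition major_direction :: "(complex \<Rightarrow> real^3) \<Rightarrow> complex \<Rightarrow> complex \<Rightarrow> bool" where
  "major_direction X u v \<longleftrightarrow>
     (\<exists>k. principal_vector X u k (frechet_derivative X (at u) v) \<and>
          (\<forall>k'. principal_curvature X u k' \<longrightarrow> k' \<le> k))"

text \<open>
  The index is measured in every local parametrization around \<open>p\<close> and along every small simple
  closed curve running once counterclockwise around \<open>p\<close>. Each parametrization is positively
  oriented for the normal it defines. Since \<open>p\<close> is an isolated umbilic, there is a
  parametrization around \<open>p\<close>, and off \<open>p\<close> the principal lines are one-dimensional, so that
  two continuous angle functions differ by a constant; hence at most one \<open>i\<close> satisfies
  the condition.
\<close>

definition has_umbilic_index :: "(real^3) set \<Rightarrow> real^3 \<Rightarrow> real \<Rightarrow> bool" where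
  "has_umbilic_index M p i \<longleftrightarrow>
     p isolated_in umbilic_points M \<and>
     (\<forall>U X u. local_parametrization M U X \<and> u \<in> U \<and> X u = p \<longrightarrow>
        (\<exists>r>0. \<forall>\<gamma>. simple_path \<gamma> \<and> pathfinish \<gamma> = pathstart \<gamma> \<and>
            path_image \<gamma> \<subseteq> ball u r - {u} \<and> winding_number \<gamma> u = 1 \<longrightarrow>
            (\<exists>\<theta>. continuous_on {0..1} \<theta> \<and>
                 (\<forall>t\<in>{0..1}. major_direction X (\<gamma> t) (cis (\<theta> t))) \<and>
                 i = (\<theta> 1 - \<theta> 0) / (2 * pi))))"

end

theory Submission
  imports Defs
begin

text \<open>
  A surface \<open>F = c\<close> has, up to the sign of the normal and the factor \<open>1 / norm (grad p)\<close>, the Hessian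
  of \<open>F\<close> restricted to the tangent plane as its second fundamental form. Hence \<open>p\<close> is
  umbilic exactly if that restriction is a multiple of the inner product
  (\<open>umbilic_points_eq\<close>), a condition without any chart. Here \<open>F\<close> is a sum of functions of one
  coordinate each, so its Hessian is diagonal, and the condition becomes six scalar equations
  (\<open>diagonal_scalar_on_plane_iff\<close>). They leave five kinds of points: the two poles \<open>x = y = 0\<close>,
  points on the meridians \<open>x = 0\<close> and \<open>y = 0\<close>, points on the equator \<open>z = 0\<close>, and points off all
  coordinate planes, where the three diagonal entries of the Hessian must agree.

  For \<open>a > b\<close> the equator and the points off the coordinate planes are excluded by sign. On a
  meridian the equations are linear in \<open>(a + 2 \<epsilon> y\<^sup>2)\<^sup>2\<close> and \<open>z\<^sup>2\<close>, with
  solutions exactly above the threshold. For \<open>a < b\<close> the meridians are excluded by sign, and the points off the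
  planes satisfy \<open>x\<^sup>2 = y\<^sup>2 = (b - a) / (6 \<epsilon>)\<close>. The count of 18 needs eight further points, on the
  equator. With \<open>u = a + 2 \<epsilon> x\<^sup>2\<close> and \<open>v = a + 2 \<epsilon> y\<^sup>2\<close> the equator is the circle
  \<open>u\<^sup>2 + v\<^sup>2 = 2 a\<^sup>2 + 4 \<epsilon>\<close>, and on this circle the symmetric umbilic equation is a cubic in the single
  variable \<open>u + v\<close>, strictly increasing in the relevant range. So there is exactly one unordered
  pair \<open>{u, v}\<close> above the threshold and none below (\<open>equator_solutions_unique\<close>,
  \<open>equator_solution_exists\<close>, \<open>equator_no_solution\<close>).

  For the index it suffices to find a tangent field \<open>Z\<close> near the umbilic that is nowhere
  principal and that vanishes at the umbilic like a source (\<open>umbilic_index_one\<close>). Since \<open>Z\<close> is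
  not principal, one of the two unit choices of the major direction makes an acute angle with
  \<open>Z\<close>; this choice is continuous and rotates as often as \<open>Z\<close>. Read in a chart, \<open>Z\<close> in turn never
  points opposite to the radial field, so it turns once along a loop around the umbilic. This treats
  charts of both orientations alike. At the poles such a field is
  obtained by turning the radial field by 45 degrees and rescaling its two components so that the
  terms of the principal direction equation with a common sign add up (\<open>pole_index\<close>); for \<open>a > b\<close>
  this works up to and including the threshold, where the linearised equation degenerates.
\<close>

no_notation fps_nth (infixl "$" 75)

section \<open>Functions of class C^k\<close>


text \<open>
  A derivative at a point of an open set sees only the values nearby, so the iterated derivatives of
  two functions that agree on the set agree there as well.
\<close>

lemma Ck_on_cong:
  assumes "open U" "\<And>x. x \<in> U \<Longrightarrow> f x = g x" "Ck_on n U f"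
  shows "Ck_on n U g"
  using assms(2,3)
proof (induction n arbitrary: f g)
  case 0
  then show ?case by (simp cong: continuous_on_cong)
next
  case (Suc n)
  have "g differentiable (at x)" if "x \<in> U" for x
  proof -
    have "(f has_derivative frechet_derivative f (at x)) (at x)"
      using Suc.prems that by (simp flip: frechet_derivative_works)
    then show ?thesis
      using has_derivative_transform_within_open[OF _ \<open>open U\<close> that] Suc.prems(1)
      by (blast intro: differentiableI)
  qed
  moreover have "Ck_on n U (\<lambda>x. frechet_derivative g (at x) v)" for v
  proof (rule Suc.IH[of "\<lambda>x. frechet_derivative f (at x) v"])
    fix x assume "x \<in> U"
    then show "frechet_derivative f (at x) v = frechet_derivative g (at x) v"
      using frechet_derivative_transform_within_open[of f x U g] Suc.prems \<open>open U\<close> by auto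
  qed (use Suc.prems in simp)
  ultimately show ?case by simp
qed

text \<open>
  The way to establish smoothness from a derivative in closed form, without reference to
  \<^const>\<open>frechet_derivative\<close>.
\<close>

lemma Ck_on_SucI:
  assumes "open U" "\<And>x. x \<in> U \<Longrightarrow> (f has_derivative f' x) (at x)"
    and "\<And>v. Ck_on n U (\<lambda>x. f' x v)"
  shows "Ck_on (Suc n) U f"
proof -
  have "Ck_on n U (\<lambda>x. frechet_derivative f (at x) v)" for v
  proof (rule Ck_on_cong[OF \<open>open U\<close> _ assms(3)[of v]])
    fix x assume "x \<in> U"
    then show "f' x v = frechet_derivative f (at x) v"
      using frechet_derivative_at[OF assms(2)] by simp
  qed
  moreover have "f differentiable at x" if "x \<in> U" for x
    using assms(2)[OF that] by (rule differentiableI)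
  ultimately show ?thesis by simp
qed

lemma Ck_on_SucD:
  assumes "Ck_on (Suc n) U f"
  shows "x \<in> U \<Longrightarrow> (f has_derivative frechet_derivative f (at x)) (at x)"
    and "Ck_on n U (\<lambda>x. frechet_derivative f (at x) v)"
  using assms by (auto simp flip: frechet_derivative_works)

lemma Ck_on_continuous: "Ck_on n U f \<Longrightarrow> continuous_on U f"
  by (cases n) (auto intro: differentiable_imp_continuous_on
      simp: differentiable_at_imp_differentiable_on)

lemma Ck_on_lower: "Ck_on (Suc n) U f \<Longrightarrow> Ck_on n U f"
proof (induction n arbitrary: f)
  case 0
  then show ?case using Ck_on_continuous[of 1] by simp
next
  case (Suc n)
  have "\<forall>v. Ck_on n U (\<lambda>x. frechet_derivative f (at x) v)"
    by (intro allI Suc.IH[OF Ck_on_SucD(2)[OF Suc.prems]])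
  moreover have "\<forall>x\<in>U. f differentiable at x"
    using Suc.prems unfolding Ck_on.simps(2)[of "Suc n"] by (rule conjunct1)
  ultimately show ?case unfolding Ck_on.simps(2)[of n] by (intro conjI)
qed

lemma Ck_on_const: "open U \<Longrightarrow> Ck_on n U (\<lambda>x. c)"
proof (induction n arbitrary: c)
  case (Suc n)
  then show ?case
    by (intro Ck_on_SucI[where f' = "\<lambda>x v. 0"]) auto
qed simp

lemma Ck_on_bounded_linear:
  assumes "open U" "bounded_linear f" shows "Ck_on n U f"
proof (cases n)
  case 0
  then show ?thesis using assms by (simp add: linear_continuous_on)
next
  case (Suc m)
  show ?thesis unfolding Suc
    by (rule Ck_on_SucI[where f' = "\<lambda>x. f"])
      (use assms Ck_on_const in \<open>auto intro: bounded_linear_imp_has_derivative\<close>)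
qed

lemma Ck_on_add:
  assumes "open U" "Ck_on n U f" "Ck_on n U g"
  shows "Ck_on n U (\<lambda>x. f x + g x)"
  using assms(2,3)
proof (induction n arbitrary: f g)
  case (Suc n)
  have "Ck_on n U (\<lambda>x. frechet_derivative f (at x) v + frechet_derivative g (at x) v)" for v
    by (intro Suc.IH Ck_on_SucD(2)[OF Suc.prems(1)] Ck_on_SucD(2)[OF Suc.prems(2)])
  moreover have "((\<lambda>x. f x + g x) has_derivative
      (\<lambda>v. frechet_derivative f (at x) v + frechet_derivative g (at x) v)) (at x)" if "x \<in> U" for x
    by (intro has_derivative_add Ck_on_SucD(1)[OF Suc.prems(1)] Ck_on_SucD(1)[OF Suc.prems(2)] that)
  ultimately show ?case by (intro Ck_on_SucI[OF \<open>open U\<close>])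
qed (simp add: continuous_on_add)

lemma Ck_on_scaleR:
  fixes f :: "'a::euclidean_space \<Rightarrow> real"
  assumes "open U" "Ck_on n U f" "Ck_on n U g"
  shows "Ck_on n U (\<lambda>x. f x *\<^sub>R g x)"
  using assms(2,3)
proof (induction n arbitrary: f g)
  case (Suc n)
  let ?f' = "\<lambda>x. frechet_derivative f (at x)" and ?g' = "\<lambda>x. frechet_derivative g (at x)"
  have "Ck_on n U (\<lambda>x. f x *\<^sub>R ?g' x v + ?f' x v *\<^sub>R g x)" for v
    by (intro Ck_on_add \<open>open U\<close> Suc.IH Ck_on_lower[OF Suc.prems(1)] Ck_on_lower[OF Suc.prems(2)]
        Ck_on_SucD(2)[OF Suc.prems(1)] Ck_on_SucD(2)[OF Suc.prems(2)])
  moreover have "((\<lambda>x. f x *\<^sub>R g x) has_derivative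
      (\<lambda>v. f x *\<^sub>R ?g' x v + ?f' x v *\<^sub>R g x)) (at x)" if "x \<in> U" for x
    by (intro has_derivative_scaleR Ck_on_SucD(1)[OF Suc.prems(1)] Ck_on_SucD(1)[OF Suc.prems(2)] that)
  ultimately show ?case by (intro Ck_on_SucI[OF \<open>open U\<close>])
qed (simp add: continuous_on_scaleR)

lemma Ck_on_mult:
  fixes f g :: "'a::euclidean_space \<Rightarrow> real"
  assumes "open U" "Ck_on n U f" "Ck_on n U g"
  shows "Ck_on n U (\<lambda>x. f x * g x)"
  using Ck_on_scaleR[OF assms] by simp

text \<open>
  Stating this for all real exponents at once closes the induction, because the derivative
  of a power is a product containing a power with another exponent. Square roots and quotients
  are special cases.
\<close>

lemma Ck_on_powr:
  fixes f :: "'a::euclidean_space \<Rightarrow> real"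
  assumes "open U" and pos: "\<And>x. x \<in> U \<Longrightarrow> f x > 0" and "Ck_on n U f"
  shows "Ck_on n U (\<lambda>x. f x powr r)"
  using assms(3)
proof (induction n arbitrary: r)
  case 0
  have "continuous_on U (\<lambda>x. f x powr r)"
    using 0 pos by (intro continuous_intros) (auto dest!: pos)
  then show ?case by simp
next
  case (Suc n)
  let ?f' = "\<lambda>x. frechet_derivative f (at x)"
  have "Ck_on n U (\<lambda>x. ?f' x v * (r * f x powr (r - 1)))" for v
    using Suc.IH[OF Ck_on_lower[OF Suc.prems]] Ck_on_SucD(2)[OF Suc.prems] \<open>open U\<close>
    by (intro Ck_on_mult Ck_on_const) auto
  moreover have "((\<lambda>x. f x powr r) has_derivative (\<lambda>v. ?f' x v * (r * f x powr (r - 1)))) (at x)"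
    if "x \<in> U" for x
    by (intro DERIV_compose_FDERIV has_real_derivative_powr pos that Ck_on_SucD(1)[OF Suc.prems])
  ultimately show ?case by (intro Ck_on_SucI[OF \<open>open U\<close>])
qed

lemma Ck_on_sqrt:
  fixes f :: "'a::euclidean_space \<Rightarrow> real"
  assumes "open U" "\<And>x. x \<in> U \<Longrightarrow> f x > 0" "Ck_on n U f"
  shows "Ck_on n U (\<lambda>x. sqrt (f x))"
  by (rule Ck_on_cong[OF assms(1) _ Ck_on_powr[OF assms, of "1/2"]])
    (use assms(2) in \<open>simp_all add: powr_half_sqrt less_imp_le\<close>)

lemma Ck_on_divide:
  fixes f g :: "'a::euclidean_space \<Rightarrow> real"
  assumes "open U" "\<And>x. x \<in> U \<Longrightarrow> g x > 0" "Ck_on n U f" "Ck_on n U g"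
  shows "Ck_on n U (\<lambda>x. f x / g x)"
  by (rule Ck_on_cong[OF assms(1) _ Ck_on_mult[OF assms(1,3) Ck_on_powr[OF assms(1,2,4), of "-1"]]])
    (use assms(2) in \<open>simp_all add: powr_minus_divide less_imp_le\<close>)

lemma Ck_on_vec:
  fixes f :: "'a::euclidean_space \<Rightarrow> real ^ 'n"
  assumes "open U" "\<And>i. Ck_on n U (\<lambda>x. f x $ i)"
  shows "Ck_on n U f"
proof -
  have "Ck_on n U (\<lambda>x. \<Sum>i\<in>I. (f x $ i) *\<^sub>R axis i 1)" if "finite I" for I
    using that
    by induction (auto intro!: Ck_on_const Ck_on_add Ck_on_scaleR assms)
  moreover have "(\<Sum>i\<in>UNIV. (f x $ i) *\<^sub>R axis i 1) = f x" for x
    using basis_expansion[of "f x"] by (simp only: scalar_mult_eq_scaleR)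
  ultimately show ?thesis by (metis (no_types, lifting) ext finite_class.finite_UNIV)
qed

section \<open>Local parametrizations\<close>

lemma chart_open: "local_parametrization M U X \<Longrightarrow> open U"
  and chart_inj: "local_parametrization M U X \<Longrightarrow> u \<in> U \<Longrightarrow> inj (frechet_derivative X (at u))"
  by (simp_all add: local_parametrization_def)

lemma chart_mem: "local_parametrization M U X \<Longrightarrow> u \<in> U \<Longrightarrow> X u \<in> M"
  unfolding local_parametrization_def by (auto dest: openin_imp_subset)

lemma chart_inj_on: "local_parametrization M U X \<Longrightarrow> inj_on X U"
  unfolding local_parametrization_def homeomorphism_def inj_on_def by metis

lemma chart_derivative:
  "local_parametrization M U X \<Longrightarrow> u \<in> U \<Longrightarrow> (X has_derivative frechet_derivative X (at u)) (at u)"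
  by (metis Ck_on_SucD(1) local_parametrization_def smooth_on_def)

lemma chart_derivative_continuous:
  "local_parametrization M U X \<Longrightarrow> continuous_on U (\<lambda>u. frechet_derivative X (at u) v)"
proof -
  assume "local_parametrization M U X"
  then have "Ck_on (Suc 0) U X"
    unfolding local_parametrization_def smooth_on_def by blast
  from Ck_on_SucD(2)[OF this] show ?thesis
    by (simp only: Ck_on.simps(1))
qed

lemma chart_continuous: "local_parametrization M U X \<Longrightarrow> continuous_on U X"
  unfolding local_parametrization_def smooth_on_def using Ck_on_continuous by blast

lemma chart_linear:
  "local_parametrization M U X \<Longrightarrow> u \<in> U \<Longrightarrow> linear (frechet_derivative X (at u))"
  by (blast dest: chart_derivative intro: has_derivative_linear)

lemma linear_complex_expand:
  assumes "linear (L :: complex \<Rightarrow> real^3)"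
  shows "L v = Re v *\<^sub>R L 1 + Im v *\<^sub>R L \<i>"
proof -
  have "v = Re v *\<^sub>R 1 + Im v *\<^sub>R \<i>"
    by (simp add: complex_eq_iff)
  then show ?thesis
    by (metis assms linear_add linear_cmul)
qed

lemma linear_inj_cross_nonzero:
  assumes "linear (L :: complex \<Rightarrow> real^3)" "inj L"
  shows "cross3 (L 1) (L \<i>) \<noteq> 0"
proof
  assume "cross3 (L 1) (L \<i>) = 0"
  then have "L 1 = 0 \<or> L \<i> = 0 \<or> (\<exists>c. L \<i> = c *\<^sub>R L 1)"
    by (simp add: cross_eq_0 collinear_lemma)
  moreover have "L z = 0 \<Longrightarrow> z = 0" for z
    using assms linear_injective_0 by blast
  moreover have "L \<i> = c *\<^sub>R L 1 \<Longrightarrow> L (\<i> - of_real c) = 0" for c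
    using linear_complex_expand[OF assms(1), of "\<i> - of_real c"] by simp
  ultimately have "\<i> - of_real c = 0 \<or> (1::complex) = 0 \<or> \<i> = 0" if "L \<i> = c *\<^sub>R L 1 \<or> L 1 = 0 \<or> L \<i> = 0" for c
    using that by blast
  moreover have "\<i> \<noteq> of_real c" for c
    by (simp add: complex_eq_iff)
  ultimately show False
    using \<open>L 1 = 0 \<or> L \<i> = 0 \<or> (\<exists>c. L \<i> = c *\<^sub>R L 1)\<close> by auto
qed

text \<open>
  The preimage of a tangent vector under the differential of the chart, by Cramer's rule for the
  Gram matrix of the partial derivatives. The explicit formula makes continuity in the base
  point evident.
\<close>

definition chart_coords :: "(complex \<Rightarrow> real^3) \<Rightarrow> complex \<Rightarrow> real^3 \<Rightarrow> complex" where
  "chart_coords X u w =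
    (let p = frechet_derivative X (at u) 1; q = frechet_derivative X (at u) \<i>;
         D = (p \<bullet> p) * (q \<bullet> q) - (p \<bullet> q)^2
     in Complex (((q \<bullet> q) * (w \<bullet> p) - (p \<bullet> q) * (w \<bullet> q)) / D)
                (((p \<bullet> p) * (w \<bullet> q) - (p \<bullet> q) * (w \<bullet> p)) / D))"

lemma chart_gram_nonzero:
  assumes "local_parametrization M U X" "u \<in> U"
  shows "(frechet_derivative X (at u) 1 \<bullet> frechet_derivative X (at u) 1) *
      (frechet_derivative X (at u) \<i> \<bullet> frechet_derivative X (at u) \<i>)
      - (frechet_derivative X (at u) 1 \<bullet> frechet_derivative X (at u) \<i>)^2 \<noteq> 0"
  using linear_inj_cross_nonzero[OF chart_linear[OF assms] chart_inj[OF assms]]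
    norm_cross[of "frechet_derivative X (at u) 1" "frechet_derivative X (at u) \<i>"]
  by (simp flip: power2_norm_eq_inner) (metis cancel_comm_monoid_add_class.diff_cancel norm_eq_zero power_eq_0_iff)

lemma chart_coords_derivative:
  assumes "local_parametrization M U X" "u \<in> U"
  shows "chart_coords X u (frechet_derivative X (at u) v) = v"
proof -
  define p where "p = frechet_derivative X (at u) 1"
  define q where "q = frechet_derivative X (at u) \<i>"
  have D: "(p \<bullet> p) * (q \<bullet> q) - (p \<bullet> q)^2 \<noteq> 0"
    using chart_gram_nonzero[OF assms] by (simp add: p_def q_def)
  have w: "frechet_derivative X (at u) v = Re v *\<^sub>R p + Im v *\<^sub>R q"
    unfolding p_def q_def by (rule linear_complex_expand[OF chart_linear[OF assms]])
  show ?thesis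
    unfolding chart_coords_def w Let_def p_def[symmetric] q_def[symmetric]
    using D by (simp add: complex_eq_iff inner_add_left inner_commute[of q p] divide_eq_eq)
      (simp add: algebra_simps power2_eq_square)
qed

lemma chart_coords_continuous:
  assumes "local_parametrization M U X" "S \<subseteq> U" "continuous_on S w"
  shows "continuous_on S (\<lambda>u. chart_coords X u (w u))"
proof -
  have c: "continuous_on S (\<lambda>u. frechet_derivative X (at u) v)" for v
    using chart_derivative_continuous[OF assms(1)] assms(2) continuous_on_subset by blast
  have D: "\<forall>u\<in>S. (frechet_derivative X (at u) 1 \<bullet> frechet_derivative X (at u) 1) *
      (frechet_derivative X (at u) \<i> \<bullet> frechet_derivative X (at u) \<i>)
      - (frechet_derivative X (at u) 1 \<bullet> frechet_derivative X (at u) \<i>)^2 \<noteq> 0"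
    using chart_gram_nonzero[OF assms(1)] assms(2) by blast
  show ?thesis
    unfolding chart_coords_def Let_def complex_eq_iff Complex_eq
    by (intro continuous_intros c assms(3) D)
qed

lemma cross_nonzero_orthogonal:
  fixes x y w :: "real^3"
  assumes "cross3 x y \<noteq> 0" "x \<bullet> w = 0" "y \<bullet> w = 0"
  obtains c where "w = c *\<^sub>R cross3 x y"
proof -
  have "cross3 w (cross3 x y) = 0"
    using assms by (simp add: Lagrange inner_commute)
  then have "w = 0 \<or> (\<exists>c. w = c *\<^sub>R cross3 x y)"
    using assms(1) cross_eq_0[of "cross3 x y" w] cross_skew[of w "cross3 x y"]
    by (auto simp: collinear_lemma)
  with that show thesis by (metis scaleR_zero_left)
qed

lemma sgn_parallel:
  fixes x y :: "'a::real_normed_vector"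
  assumes "x = c *\<^sub>R y" "x \<noteq> 0"
  shows "sgn y = sgn x \<or> sgn y = - sgn x"
  using assms by (cases "c > 0") (auto simp: sgn_scaleR sgn_real_def)

section \<open>The shape operator of a level surface\<close>

locale level_surface =
  fixes F :: "real^3 \<Rightarrow> real" and grad :: "real^3 \<Rightarrow> real^3"
    and hess :: "real^3 \<Rightarrow> real^3 \<Rightarrow> real^3" and c :: real and M :: "(real^3) set"
  assumes M_eq: "M = {p. F p = c}"
    and F_derivative: "(F has_derivative (\<lambda>v. grad p \<bullet> v)) (at p)"
    and grad_derivative: "(grad has_derivative hess p) (at p)"
    and grad_nonzero: "p \<in> M \<Longrightarrow> grad p \<noteq> 0"
    and hess_continuous: "continuous_on UNIV (\<lambda>(p, w). hess p w)"
    and hess_symmetric: "hess p v \<bullet> w = hess p w \<bullet> v"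
begin

lemma hess_linear: "linear (hess p)"
  by (rule has_derivative_linear[OF grad_derivative])

lemma grad_continuous: "continuous_on S grad"
  by (meson continuous_at_imp_continuous_on grad_derivative has_derivative_continuous)

text \<open>
  \<open>F\<close> is constant along the chart, so its derivative vanishes on tangent vectors.
\<close>

lemma chart_tangent:
  assumes "local_parametrization M U X" "u \<in> U"
  shows "grad (X u) \<bullet> frechet_derivative X (at u) v = 0"
proof -
  have "((\<lambda>u. F (X u)) has_derivative (\<lambda>v. grad (X u) \<bullet> frechet_derivative X (at u) v)) (at u)"
    by (rule has_derivative_compose[OF chart_derivative[OF assms] F_derivative])
  moreover have "((\<lambda>u. F (X u)) has_derivative (\<lambda>v. 0)) (at u)"
    by (rule has_derivative_transform_within_open[OF has_derivative_const[of c] chart_open[OF assms(1)] assms(2)])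
      (use chart_mem[OF assms(1)] in \<open>auto simp: M_eq\<close>)
  ultimately show ?thesis
    using has_derivative_unique by metis
qed

lemma chart_cross_parallel_grad:
  assumes "local_parametrization M U X" "u \<in> U"
  obtains k where "grad (X u) = k *\<^sub>R cross3 (frechet_derivative X (at u) 1) (frechet_derivative X (at u) \<i>)"
proof -
  have "frechet_derivative X (at u) v \<bullet> grad (X u) = 0" for v
    using chart_tangent[OF assms] by (simp add: inner_commute)
  with cross_nonzero_orthogonal[OF linear_inj_cross_nonzero[OF chart_linear[OF assms] chart_inj[OF assms]]]
  show thesis using that by metis
qed

text \<open>
  The nontrivial inclusion solves \<open>dX v = w\<close> for \<open>w\<close> orthogonal to the gradient: with \<open>N\<close> the
  cross product of the partial derivatives, \<open>w\<close> is a multiple of \<open>N \<times> (w \<times> N)\<close>, and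
  \<open>N \<times> v\<close> is a combination of the partial derivatives by the double cross product formula.
\<close>

lemma tangent_plane_eq:
  assumes "local_parametrization M U X" "u \<in> U"
  shows "tangent_plane X u = {w. grad (X u) \<bullet> w = 0}"
proof (intro equalityI subsetI)
  fix w assume "w \<in> tangent_plane X u"
  then show "w \<in> {w. grad (X u) \<bullet> w = 0}"
    using chart_tangent[OF assms] by (auto simp: tangent_plane_def)
next
  fix w assume w: "w \<in> {w. grad (X u) \<bullet> w = 0}"
  let ?L = "frechet_derivative X (at u)"
  have lin: "linear ?L" and nz: "cross3 (?L 1) (?L \<i>) \<noteq> 0"
    using chart_linear[OF assms] linear_inj_cross_nonzero chart_inj[OF assms] by auto
  obtain k where k: "grad (X u) = k *\<^sub>R cross3 (?L 1) (?L \<i>)"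
    using chart_cross_parallel_grad[OF assms] .
  have "k \<noteq> 0"
    using k grad_nonzero[OF chart_mem[OF assms]] by auto
  then have orth: "cross3 (?L 1) (?L \<i>) \<bullet> w = 0"
    using w k by simp
  define N where "N = cross3 (?L 1) (?L \<i>)"
  have "cross3 N (cross3 w N) = (N \<bullet> N) *\<^sub>R w"
    using orth[folded N_def] by (simp add: Lagrange)
  moreover have "cross3 N v \<in> range ?L" for v
  proof -
    have "cross3 N v = - (cross3 v N)"
      by (rule cross_skew)
    also have "\<dots> = (v \<bullet> ?L 1) *\<^sub>R ?L \<i> - (v \<bullet> ?L \<i>) *\<^sub>R ?L 1"
      unfolding N_def Lagrange by simp
    also have "\<dots> = ?L (Complex (- (v \<bullet> ?L \<i>)) (v \<bullet> ?L 1))"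
      by (subst (3) linear_complex_expand[OF lin]) simp
    finally show ?thesis by simp
  qed
  ultimately obtain v where v: "?L v = (N \<bullet> N) *\<^sub>R w"
    by (metis imageE)
  have "N \<noteq> 0" using nz by (simp add: N_def)
  then have "?L ((1 / (N \<bullet> N)) *\<^sub>R v) = w"
    using v by (simp add: linear_cmul[OF lin])
  then show "w \<in> tangent_plane X u"
    unfolding tangent_plane_def by (metis rangeI)
qed

text \<open>
  The normal of a chart and the normalized gradient agree up to a sign that is a continuous function
  of the point, hence locally constant. A constant sign is what allows the normal to be
  differentiated.
\<close>

lemma unit_normal_eq_sgn_grad:
  assumes "local_parametrization M U X" "u \<in> U"
  obtains r \<sigma> where "r > 0" "ball u r \<subseteq> U" "\<sigma> = 1 \<or> \<sigma> = (-1::real)"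
    "\<And>v. v \<in> ball u r \<Longrightarrow> unit_normal X v = \<sigma> *\<^sub>R sgn (grad (X v))"
proof -
  define s where "s v = unit_normal X v \<bullet> sgn (grad (X v))" for v
  have gnz: "grad (X v) \<noteq> 0" if "v \<in> U" for v
    using grad_nonzero chart_mem assms that by blast
  have s: "(s v = 1 \<or> s v = -1) \<and> unit_normal X v = s v *\<^sub>R sgn (grad (X v))" if v: "v \<in> U" for v
  proof -
    obtain k where k: "grad (X v) = k *\<^sub>R cross3 (frechet_derivative X (at v) 1) (frechet_derivative X (at v) \<i>)"
      using chart_cross_parallel_grad[OF assms(1) v] .
    have "unit_normal X v = sgn (grad (X v)) \<or> unit_normal X v = - sgn (grad (X v))"
      unfolding unit_normal_def by (rule sgn_parallel[OF k gnz[OF that]])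
    moreover have "sgn (grad (X v)) \<bullet> sgn (grad (X v)) = 1"
      using gnz[OF that] by (simp add: norm_sgn flip: power2_norm_eq_inner)
    ultimately show ?thesis by (auto simp: s_def)
  qed
  have "continuous_on U (\<lambda>v. grad (X v))"
    by (rule continuous_on_compose2[OF grad_continuous chart_continuous[OF assms(1)]]) auto
  moreover have "continuous_on U (unit_normal X)"
    unfolding unit_normal_def[abs_def]
    by (intro continuous_on_sgn continuous_on_cross chart_derivative_continuous[OF assms(1)])
      (use linear_inj_cross_nonzero chart_linear chart_inj assms(1) in blast)
  ultimately have "continuous_on U s"
    unfolding s_def[abs_def] using gnz by (intro continuous_intros continuous_on_sgn) auto
  then have "isCont s u"
    using chart_open[OF assms(1)] assms(2) continuous_on_eq_continuous_at by blast
  then obtain d where d: "d > 0" "\<And>v. dist v u < d \<Longrightarrow> dist (s v) (s u) < 1"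
    by (metis continuous_at_eps_delta dist_commute zero_less_one dist_norm)
  obtain e where e: "e > 0" "ball u e \<subseteq> U"
    using chart_open[OF assms(1)] assms(2) open_contains_ball by blast
  show thesis
  proof (rule that[of "min d e" "s u"])
    fix v assume v: "v \<in> ball u (min d e)"
    then have "v \<in> U" using e by auto
    moreover have "dist (s v) (s u) < 1"
      using v d(2)[of v] by (simp add: dist_commute[of u v])
    ultimately have "s v = s u"
      using s[of v] s[OF assms(2)] by (auto simp: dist_real_def)
    with s[OF \<open>v \<in> U\<close>] show "unit_normal X v = s u *\<^sub>R sgn (grad (X v))" by metis
  qed (use d e s[OF assms(2)] in auto)
qed

text \<open>
  Differentiating \<open>grad / norm grad\<close> gives the Hessian divided by the norm of the gradient, plus a
  multiple of the gradient; tangent vectors do not see the latter, so the derivative of the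
  norm need not be computed.
\<close>

lemma shape_operator_inner:
  assumes chart: "local_parametrization M U X" and u: "u \<in> U"
    and B: "open B" "u \<in> B"
    and normal: "\<And>v. v \<in> B \<Longrightarrow> unit_normal X v = \<sigma> *\<^sub>R sgn (grad (X v))"
    and tangent: "grad (X u) \<bullet> w = 0" "grad (X u) \<bullet> w' = 0"
  shows "shape_operator X u w \<bullet> w' = - (\<sigma> / norm (grad (X u))) * (hess (X u) w \<bullet> w')"
    and "shape_operator X u w \<bullet> grad (X u) = 0"
proof -
  let ?L = "frechet_derivative X (at u)"
  define G where "G v = grad (X v)" for v
  have Gnz: "G u \<noteq> 0" using grad_nonzero[OF chart_mem[OF chart u]] by (simp add: G_def)
  have GD: "(G has_derivative (\<lambda>v. hess (X u) (?L v))) (at u)"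
    unfolding G_def[abs_def]
    by (rule has_derivative_compose[OF chart_derivative[OF chart u] grad_derivative])
  have "(\<lambda>v. inverse (norm (G v))) differentiable (at u)"
    using GD Gnz
    by (intro differentiable_inverse differentiable_compose[OF differentiable_norm_at])
      (auto intro: differentiableI)
  then obtain \<phi> where \<phi>: "((\<lambda>v. inverse (norm (G v))) has_derivative \<phi>) (at u)"
    by (auto simp: differentiable_def)
  have sgnD: "((\<lambda>v. sgn (G v)) has_derivative
      (\<lambda>v. inverse (norm (G u)) *\<^sub>R hess (X u) (?L v) + \<phi> v *\<^sub>R G u)) (at u)"
    unfolding sgn_div_norm by (rule has_derivative_scaleR[OF \<phi> GD])
  have "((\<lambda>v. \<sigma> *\<^sub>R sgn (G v)) has_derivative
      (\<lambda>v. \<sigma> *\<^sub>R (inverse (norm (G u)) *\<^sub>R hess (X u) (?L v) + \<phi> v *\<^sub>R G u))) (at u)"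
    by (rule has_derivative_scaleR_right[OF sgnD])
  then have "(unit_normal X has_derivative
      (\<lambda>v. \<sigma> *\<^sub>R (inverse (norm (G u)) *\<^sub>R hess (X u) (?L v) + \<phi> v *\<^sub>R G u))) (at u)"
    by (rule has_derivative_transform_within_open[OF _ B]) (simp add: normal G_def)
  then have N': "frechet_derivative (unit_normal X) (at u) =
      (\<lambda>v. \<sigma> *\<^sub>R (inverse (norm (G u)) *\<^sub>R hess (X u) (?L v) + \<phi> v *\<^sub>R G u))"
    by (rule frechet_derivative_at[symmetric])
  obtain v where v: "w = ?L v"
    using tangent(1) tangent_plane_eq[OF chart u] by (auto simp: tangent_plane_def)
  have inv: "inv ?L w = v"
    using v chart_inj[OF chart u] by simp
  show "shape_operator X u w \<bullet> w' = - (\<sigma> / norm (grad (X u))) * (hess (X u) w \<bullet> w')"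
    using tangent(2) unfolding shape_operator_def N' inv v[symmetric]
    by (simp add: inner_add_left G_def divide_inverse)
  have "((\<lambda>v. sgn (G v) \<bullet> sgn (G v)) has_derivative (\<lambda>v. 0)) (at u)"
  proof (rule has_derivative_transform_within_open[OF has_derivative_const[of 1] chart_open[OF chart] u])
    fix v assume "v \<in> U"
    then have "G v \<noteq> 0" using grad_nonzero[OF chart_mem[OF chart]] by (simp add: G_def)
    then show "1 = sgn (G v) \<bullet> sgn (G v)"
      by (simp add: norm_sgn flip: power2_norm_eq_inner)
  qed
  from fun_cong[OF has_derivative_unique[OF this has_derivative_inner[OF sgnD sgnD]], of v]
  have "sgn (G u) \<bullet> (inverse (norm (G u)) *\<^sub>R hess (X u) w + \<phi> v *\<^sub>R G u) = 0"
    unfolding v by (simp only: inner_commute[of _ "sgn (G u)"])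
  then have "G u \<bullet> (inverse (norm (G u)) *\<^sub>R hess (X u) w + \<phi> v *\<^sub>R G u) = 0"
    using Gnz by (simp add: sgn_div_norm)
  then show "shape_operator X u w \<bullet> grad (X u) = 0"
    unfolding shape_operator_def N' inv v[symmetric]
    by (simp add: inner_commute G_def)
qed

text \<open>
  Umbilicity of a level surface without a chart: the second fundamental form is proportional
  to the metric on the tangent plane.
\<close>

definition hess_umbilic :: "real^3 \<Rightarrow> bool" where
  "hess_umbilic p \<longleftrightarrow> (\<exists>k. \<forall>w w'. grad p \<bullet> w = 0 \<longrightarrow> grad p \<bullet> w' = 0 \<longrightarrow> hess p w \<bullet> w' = k * (w \<bullet> w'))"

lemma orthogonal_tangent_normal_eq_0:
  assumes "\<And>w'. grad p \<bullet> w' = 0 \<Longrightarrow> x \<bullet> w' = 0" "x \<bullet> grad p = 0"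
  shows "x = 0"
  using assms(1)[of x] assms(2) by (simp add: inner_commute)

lemma shape_scalar_iff_hess_umbilic:
  assumes chart: "local_parametrization M U X" and u: "u \<in> U"
  shows "(\<exists>k. \<forall>w\<in>tangent_plane X u. shape_operator X u w = k *\<^sub>R w) \<longleftrightarrow> hess_umbilic (X u)"
proof -
  obtain r \<sigma> where r: "r > 0" "ball u r \<subseteq> U" and \<sigma>: "\<sigma> = 1 \<or> \<sigma> = (-1::real)"
    and n: "\<And>v. v \<in> ball u r \<Longrightarrow> unit_normal X v = \<sigma> *\<^sub>R sgn (grad (X v))"
    using unit_normal_eq_sgn_grad[OF chart u] by metis
  have ub: "u \<in> ball u r" using r by simp
  note inner = shape_operator_inner[OF chart u open_ball ub n]
  define \<kappa> where "\<kappa> = - (\<sigma> / norm (grad (X u)))"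
  have "\<kappa> \<noteq> 0" using \<sigma> grad_nonzero[OF chart_mem[OF chart u]] by (auto simp: \<kappa>_def)
  show ?thesis
  proof
    assume "\<exists>k. \<forall>w\<in>tangent_plane X u. shape_operator X u w = k *\<^sub>R w"
    then obtain k where k: "\<And>w. grad (X u) \<bullet> w = 0 \<Longrightarrow> shape_operator X u w = k *\<^sub>R w"
      using tangent_plane_eq[OF chart u] by auto
    have "hess (X u) w \<bullet> w' = k / \<kappa> * (w \<bullet> w')"
      if "grad (X u) \<bullet> w = 0" "grad (X u) \<bullet> w' = 0" for w w'
      using inner(1)[OF _ that] k[OF that(1)] \<open>\<kappa> \<noteq> 0\<close> by (simp add: \<kappa>_def[symmetric] field_simps)
    then show "hess_umbilic (X u)" unfolding hess_umbilic_def by blast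
  next
    assume "hess_umbilic (X u)"
    then obtain k where k: "\<And>w w'. grad (X u) \<bullet> w = 0 \<Longrightarrow> grad (X u) \<bullet> w' = 0 \<Longrightarrow>
        hess (X u) w \<bullet> w' = k * (w \<bullet> w')"
      by (auto simp: hess_umbilic_def)
    have "shape_operator X u w - (\<kappa> * k) *\<^sub>R w = 0" if "grad (X u) \<bullet> w = 0" for w
      by (rule orthogonal_tangent_normal_eq_0[of "X u"])
        (use inner[OF _ that] k[OF that] that in
          \<open>simp_all add: \<kappa>_def[symmetric] inner_diff_left inner_commute[of w]\<close>)
    then show "\<exists>k. \<forall>w\<in>tangent_plane X u. shape_operator X u w = k *\<^sub>R w"
      using tangent_plane_eq[OF chart u] by auto
  qed
qed

text \<open>
  The right-hand side contains no chart, whereas \<^const>\<open>umbilic_points\<close> asks for one; this is why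
  the surface has to be covered by local parametrizations.
\<close>

lemma umbilic_points_eq:
  assumes "\<And>p. p \<in> M \<Longrightarrow> \<exists>U X. local_parametrization M U X \<and> p \<in> X ` U"
  shows "umbilic_points M = {p \<in> M. hess_umbilic p}"
proof (intro equalityI subsetI)
  fix p assume "p \<in> umbilic_points M"
  then obtain U X u where *: "local_parametrization M U X" "u \<in> U" "X u = p"
    "\<exists>k. \<forall>w\<in>tangent_plane X u. shape_operator X u w = k *\<^sub>R w"
    unfolding umbilic_points_def by blast
  then show "p \<in> {p \<in> M. hess_umbilic p}"
    using shape_scalar_iff_hess_umbilic[OF *(1,2)] chart_mem[OF *(1,2)] by simp
next
  fix p assume p: "p \<in> {p \<in> M. hess_umbilic p}"
  then obtain U X u where *: "local_parametrization M U X" "u \<in> U" "X u = p"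
    using assms[of p] by blast
  then show "p \<in> umbilic_points M"
    using shape_scalar_iff_hess_umbilic[OF *(1,2)] p unfolding umbilic_points_def by blast
qed

end

section \<open>Principal directions and the index of an umbilic\<close>

text \<open>
  The left-hand side is the characteristic equation of a symmetric matrix with diagonal \<open>e\<close>, \<open>g\<close>
  and off-diagonal entry \<open>f\<close>; the bound is its larger eigenvalue.
\<close>

lemma larger_root:
  fixes e f g k :: real
  assumes "(k - e) * (k - g) = f\<^sup>2"
  shows "k \<le> (e + g) / 2 + sqrt (((g - e) / 2)\<^sup>2 + f\<^sup>2)"
proof -
  have "(k - (e + g) / 2)\<^sup>2 = ((g - e) / 2)\<^sup>2 + f\<^sup>2"
    using assms by (simp add: field_simps power2_eq_square)
  then have "\<bar>k - (e + g) / 2\<bar> = sqrt (((g - e) / 2)\<^sup>2 + f\<^sup>2)"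
    by (metis real_sqrt_abs)
  then show ?thesis by linarith
qed

lemma sqrt_gt_half_diff:
  fixes f x :: real
  assumes "f \<noteq> 0" shows "x + sqrt (x\<^sup>2 + f\<^sup>2) > 0"
proof -
  have "sqrt (x\<^sup>2) < sqrt (x\<^sup>2 + f\<^sup>2)" using assms by (intro real_sqrt_less_mono) simp
  then show ?thesis by simp
qed

lemma tangent_basis_expand:
  fixes n z w :: "real^3"
  assumes "norm n = 1" "n \<bullet> z = 0" "z \<noteq> 0" "n \<bullet> w = 0"
  shows "w = ((w \<bullet> cross3 n z) / (z \<bullet> z)) *\<^sub>R cross3 n z + ((w \<bullet> z) / (z \<bullet> z)) *\<^sub>R z"
    and "cross3 n z \<bullet> cross3 n z = z \<bullet> z"
proof -
  have nn: "n \<bullet> n = 1" using assms(1) by (simp add: norm_eq_1)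
  show yy: "cross3 n z \<bullet> cross3 n z = z \<bullet> z"
    using assms(2) nn by (simp add: dot_cross inner_commute[of z n])
  define x where "x = (z \<bullet> z) *\<^sub>R w - ((w \<bullet> cross3 n z) *\<^sub>R cross3 n z + (w \<bullet> z) *\<^sub>R z)"
  have "n \<bullet> x = 0"
    using assms by (simp add: x_def inner_diff_right inner_add_right dot_cross_self)
  moreover have "x \<bullet> z = 0" "x \<bullet> cross3 n z = 0"
    using assms yy by (simp_all add: x_def inner_diff_left inner_add_left dot_cross_self)
  ultimately have "cross3 x (cross3 n z) = 0"
    by (simp add: Lagrange inner_commute[of x n])
  moreover have "(norm (cross3 x (cross3 n z)))\<^sup>2 = (norm x)\<^sup>2 * (z \<bullet> z)"
    using \<open>x \<bullet> cross3 n z = 0\<close> yy norm_cross[of x "cross3 n z"] power2_norm_eq_inner[of "cross3 n z"]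
    by (simp only: power2_eq_square mult_zero_left diff_zero)
  ultimately have "x = 0" using assms(3) by simp
  then have "(z \<bullet> z) *\<^sub>R w = (w \<bullet> cross3 n z) *\<^sub>R cross3 n z + (w \<bullet> z) *\<^sub>R z"
    by (simp add: x_def)
  then have "(1 / (z \<bullet> z)) *\<^sub>R (z \<bullet> z) *\<^sub>R w
      = (1 / (z \<bullet> z)) *\<^sub>R ((w \<bullet> cross3 n z) *\<^sub>R cross3 n z + (w \<bullet> z) *\<^sub>R z)" by simp
  then show "w = ((w \<bullet> cross3 n z) / (z \<bullet> z)) *\<^sub>R cross3 n z + ((w \<bullet> z) / (z \<bullet> z)) *\<^sub>R z"
    using assms(3) by (simp add: scaleR_add_right)
qed

context level_surface
begin

text \<open>
  The eigenvector equation may be tested against tangent vectors, because the shape operator has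
  values in the tangent plane.
\<close>

lemma principal_vector_iff:
  assumes chart: "local_parametrization M U X" and u: "u \<in> U"
    and B: "open B" "u \<in> B"
    and normal: "\<And>v. v \<in> B \<Longrightarrow> unit_normal X v = \<sigma> *\<^sub>R sgn (grad (X v))"
  shows "principal_vector X u k w \<longleftrightarrow> grad (X u) \<bullet> w = 0 \<and> w \<noteq> 0 \<and>
    (\<forall>w'. grad (X u) \<bullet> w' = 0 \<longrightarrow> - (\<sigma> / norm (grad (X u))) * (hess (X u) w \<bullet> w') = k * (w \<bullet> w'))"
    (is "?l \<longleftrightarrow> ?r")
proof
  assume ?l
  then show ?r
    using shape_operator_inner(1)[OF chart u B normal]
    unfolding principal_vector_def tangent_plane_eq[OF chart u] by fastforce
next
  assume r: ?r
  then have w: "grad (X u) \<bullet> w = 0" by blast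
  have "shape_operator X u w - k *\<^sub>R w = 0"
  proof (rule orthogonal_tangent_normal_eq_0[of "X u"])
    fix w' assume w': "grad (X u) \<bullet> w' = 0"
    show "(shape_operator X u w - k *\<^sub>R w) \<bullet> w' = 0"
      using r w' shape_operator_inner(1)[OF chart u B normal w w'] by (simp add: inner_diff_left)
  next
    show "(shape_operator X u w - k *\<^sub>R w) \<bullet> grad (X u) = 0"
      using w shape_operator_inner(2)[OF chart u B normal w w] by (simp add: inner_diff_left inner_commute[of w])
  qed
  with r show ?l
    unfolding principal_vector_def tangent_plane_eq[OF chart u] by simp
qed

text \<open>
  In the orthogonal frame \<open>y = n \<times> z\<close>, \<open>z\<close> of the tangent plane, an eigenvector of a
  symmetric matrix with entries \<open>e\<close>, \<open>f\<close>, \<open>g\<close> for its larger eigenvalue \<open>\<lambda>\<close> is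
  \<open>f y + (\<lambda> - e) z\<close>; the coefficient of \<open>z\<close> below is \<open>\<lambda> - e\<close>. The factor \<open>\<kappa>\<close> stands for
  \<open>\<plusminus> 1 / norm (grad p)\<close>, which turns the Hessian into the second fundamental form.
\<close>

definition major_tangent :: "real \<Rightarrow> real^3 \<Rightarrow> real^3 \<Rightarrow> real^3" where
  "major_tangent \<kappa> p z =
    (let y = cross3 (sgn (grad p)) z;
         e = \<kappa> * (hess p y \<bullet> y); f = \<kappa> * (hess p y \<bullet> z); g = \<kappa> * (hess p z \<bullet> z)
     in f *\<^sub>R y + ((g - e) / 2 + sqrt (((g - e) / 2)\<^sup>2 + f\<^sup>2)) *\<^sub>R z)"

lemma hess_cross_sgn_nonzero:
  assumes "hess p z \<bullet> cross3 (grad p) z \<noteq> 0"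
  shows "hess p (cross3 (sgn (grad p)) z) \<bullet> z \<noteq> 0"
proof -
  have "hess p (cross3 (sgn (grad p)) z) \<bullet> z = hess p z \<bullet> cross3 (sgn (grad p)) z"
    by (rule hess_symmetric)
  also have "\<dots> = inverse (norm (grad p)) * (hess p z \<bullet> cross3 (grad p) z)"
    by (simp add: sgn_div_norm cross_mult_left)
  finally show ?thesis using assms by auto
qed

text \<open>
  If \<open>z\<close> is not principal then \<open>f \<noteq> 0\<close>, so \<open>\<lambda> - e > 0\<close>: the chosen major vector never vanishes
  and never points opposite to \<open>z\<close>. This is what ties its rotation to that of \<open>z\<close>.
\<close>

lemma major_tangent_inner:
  assumes "\<kappa> \<noteq> 0" "hess p z \<bullet> cross3 (grad p) z \<noteq> 0"
  shows "major_tangent \<kappa> p z \<bullet> z > 0"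
proof -
  define y where "y = cross3 (sgn (grad p)) z"
  have f: "\<kappa> * (hess p y \<bullet> z) \<noteq> 0"
    using hess_cross_sgn_nonzero[OF assms(2)] assms(1) by (simp add: y_def)
  have "z \<noteq> 0" using assms(2) by auto
  moreover have "y \<bullet> z = 0" by (simp add: y_def dot_cross_self)
  ultimately show ?thesis
    using sqrt_gt_half_diff[OF f]
    by (simp add: major_tangent_def Let_def inner_add_left flip: y_def)
qed

text \<open>
  With the entries \<open>e\<close>, \<open>f\<close>, \<open>g\<close> of the second fundamental form in the frame \<open>y\<close>, \<open>z\<close>, both parts are the
  characteristic equation: its root \<open>e + h\<close> makes the vector an eigenvector, and every other
  principal curvature satisfies the same equation and is bounded by the larger root. The frame
  vectors have common square length \<open>s\<close> instead of one, so eigenvalues appear divided by \<open>s\<close>.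
\<close>

lemma major_direction_major_tangent:
  assumes chart: "local_parametrization M U X" and u: "u \<in> U"
    and B: "open B" "u \<in> B"
    and normal: "\<And>v. v \<in> B \<Longrightarrow> unit_normal X v = \<sigma> *\<^sub>R sgn (grad (X v))"
    and \<sigma>: "\<sigma> \<noteq> 0"
    and z: "grad (X u) \<bullet> z = 0" "hess (X u) z \<bullet> cross3 (grad (X u)) z \<noteq> 0"
    and v: "frechet_derivative X (at u) v = r *\<^sub>R major_tangent (- (\<sigma> / norm (grad (X u)))) (X u) z" "r \<noteq> 0"
  shows "major_direction X u v"
proof -
  define p where "p = X u"
  define n where "n = sgn (grad p)"
  define \<kappa> where "\<kappa> = - (\<sigma> / norm (grad p))"
  define y where "y = cross3 n z"
  define e where "e = \<kappa> * (hess p y \<bullet> y)"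
  define f where "f = \<kappa> * (hess p y \<bullet> z)"
  define g where "g = \<kappa> * (hess p z \<bullet> z)"
  define h where "h = (g - e) / 2 + sqrt (((g - e) / 2)\<^sup>2 + f\<^sup>2)"
  define w where "w = major_tangent \<kappa> p z"
  have w: "w = f *\<^sub>R y + h *\<^sub>R z"
    by (simp add: w_def major_tangent_def Let_def y_def e_def f_def g_def h_def n_def)
  have gnz: "grad p \<noteq> 0" using grad_nonzero[OF chart_mem[OF chart u]] by (simp add: p_def)
  have \<kappa>: "\<kappa> \<noteq> 0" using gnz \<sigma> by (simp add: \<kappa>_def)
  have znz: "z \<noteq> 0" using z(2) by auto
  have n1: "norm n = 1" using gnz by (simp add: n_def norm_sgn)
  have tan_n: "n \<bullet> x = 0 \<longleftrightarrow> grad p \<bullet> x = 0" for x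
    using gnz by (simp add: n_def sgn_div_norm)
  have nz: "n \<bullet> z = 0" using z(1) tan_n by (simp add: p_def)
  have ny: "n \<bullet> y = 0" by (simp add: y_def dot_cross_self)
  have yz: "y \<bullet> z = 0" "z \<bullet> y = 0" by (simp_all add: y_def dot_cross_self)
  have yy: "y \<bullet> y = z \<bullet> z"
    unfolding y_def by (rule tangent_basis_expand(2)[OF n1 nz znz nz])
  define s where "s = z \<bullet> z"
  have s: "s > 0" using znz by (simp add: s_def)
  have zz: "z \<bullet> z = s" "y \<bullet> y = s" using yy by (simp_all add: s_def)
  have bil: "\<kappa> * (hess p (a *\<^sub>R y + b *\<^sub>R z) \<bullet> (a' *\<^sub>R y + b' *\<^sub>R z))
      = a * (a' * e + b' * f) + b * (a' * f + b' * g)" for a b a' b'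
    using hess_symmetric[of p z y]
    by (simp add: linear_add[OF hess_linear] linear_cmul[OF hess_linear] inner_add_left
        inner_add_right e_def f_def g_def algebra_simps)
  have inn: "(a *\<^sub>R y + b *\<^sub>R z) \<bullet> (a' *\<^sub>R y + b' *\<^sub>R z) = (a * a' + b * b') * s" for a b a' b'
    by (simp add: inner_add_left inner_add_right yz zz algebra_simps)
  have ex: "\<exists>a b. x = a *\<^sub>R y + b *\<^sub>R z" if "grad p \<bullet> x = 0" for x
    using tangent_basis_expand(1)[OF n1 nz znz, of x] that tan_n unfolding y_def by blast
  have pv: "principal_vector X u k x \<longleftrightarrow> grad p \<bullet> x = 0 \<and> x \<noteq> 0 \<and>
      (\<forall>x'. grad p \<bullet> x' = 0 \<longrightarrow> \<kappa> * (hess p x \<bullet> x') = k * (x \<bullet> x'))" for k x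
    unfolding p_def \<kappa>_def by (rule principal_vector_iff[OF chart u B normal])
  have root: "h * (h - (g - e)) = f\<^sup>2"
  proof -
    have "(h - (g - e) / 2)\<^sup>2 = ((g - e) / 2)\<^sup>2 + f\<^sup>2"
      by (simp add: h_def)
    then show ?thesis by (simp add: power2_eq_square field_simps)
  qed
  have wz: "w \<bullet> z > 0"
    unfolding w_def by (rule major_tangent_inner[OF \<kappa>]) (use z(2) in \<open>simp add: p_def\<close>)
  have "principal_vector X u ((e + h) / s) (r *\<^sub>R w)"
    unfolding pv
  proof (intro conjI allI impI)
    show "grad p \<bullet> r *\<^sub>R w = 0" using tan_n[of w] ny nz by (simp add: w inner_add_right)
    show "r *\<^sub>R w \<noteq> 0" using wz v(2) by auto
    fix w' assume "grad p \<bullet> w' = 0"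
    then obtain a b where w': "w' = a *\<^sub>R y + b *\<^sub>R z" using ex by blast
    have "\<kappa> * (hess p (r *\<^sub>R w) \<bullet> w') = r * (\<kappa> * (hess p w \<bullet> w'))"
      by (simp add: linear_cmul[OF hess_linear])
    also have "\<kappa> * (hess p w \<bullet> w') = f * (a * e + b * f) + h * (a * f + b * g)"
      unfolding w w' by (rule bil)
    also have "\<dots> = (e + h) * (f * a + h * b)"
      using root by (simp add: power2_eq_square algebra_simps)
    also have "\<dots> = (e + h) / s * (w \<bullet> w')"
      unfolding w w' inn using s by simp
    finally show "\<kappa> * (hess p (r *\<^sub>R w) \<bullet> w') = (e + h) / s * (r *\<^sub>R w \<bullet> w')"
      by simp
  qed
  moreover have "k' \<le> (e + h) / s" if "principal_curvature X u k'" for k'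
  proof -
    obtain x where x: "principal_vector X u k' x"
      using \<open>principal_curvature X u k'\<close> by (auto simp: principal_curvature_def)
    then obtain a b where ab: "x = a *\<^sub>R y + b *\<^sub>R z" using ex pv by blast
    have "\<kappa> * (hess p x \<bullet> y) = k' * (x \<bullet> y)" "\<kappa> * (hess p x \<bullet> z) = k' * (x \<bullet> z)"
      using x ny nz tan_n unfolding pv by blast+
    then have 1: "a * e + b * f = k' * s * a" and 2: "a * f + b * g = k' * s * b"
      using bil[of a b 1 0] inn[of a b 1 0] bil[of a b 0 1] inn[of a b 0 1] by (simp_all add: ab mult_ac)
    have "a * ((k' * s - e) * (k' * s - g) - f\<^sup>2) = 0" "b * ((k' * s - e) * (k' * s - g) - f\<^sup>2) = 0"
      using 1 2 by algebra+
    moreover have "a \<noteq> 0 \<or> b \<noteq> 0" using x ab unfolding pv by auto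
    ultimately have "(k' * s - e) * (k' * s - g) = f\<^sup>2" by auto
    from larger_root[OF this] have "k' * s \<le> e + h" by (simp add: h_def field_simps)
    then show ?thesis using s by (simp add: pos_le_divide_eq)
  qed
  moreover have "frechet_derivative X (at u) v = r *\<^sub>R w"
    using v(1) by (simp add: w_def \<kappa>_def p_def)
  ultimately show ?thesis
    unfolding major_direction_def by metis
qed

lemma major_tangent_continuous:
  fixes p z :: "complex \<Rightarrow> real^3"
  assumes "continuous_on S \<kappa>" "continuous_on S p" "continuous_on S z"
    "\<And>u. u \<in> S \<Longrightarrow> p u \<in> M"
  shows "continuous_on S (\<lambda>u. major_tangent (\<kappa> u) (p u) (z u))"
proof -
  have H: "continuous_on S (\<lambda>u. hess (p u) (w u))" if "continuous_on S w" for w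
    using continuous_on_compose2[OF hess_continuous continuous_on_Pair[OF assms(2) that]] by simp
  have "continuous_on S (\<lambda>u. grad (p u))"
    by (rule continuous_on_compose2[OF grad_continuous assms(2)]) auto
  then have y: "continuous_on S (\<lambda>u. cross3 (sgn (grad (p u))) (z u))"
    using assms grad_nonzero by (intro continuous_on_cross continuous_on_sgn) auto
  show ?thesis
    unfolding major_tangent_def Let_def
    by (intro continuous_intros H y assms) auto
qed

end

text \<open>
  To first order at \<open>u\<close> the two factors are \<open>K (dX h)\<close> and \<open>dX h\<close> with \<open>h = v - u\<close>. Their inner product is
  bounded below by a positive multiple of \<open>(norm h)\<^sup>2\<close>, by compactness of the unit circle, and
  the errors are of smaller order.
\<close>

lemma outward_field_along_chart:
  fixes X :: "complex \<Rightarrow> real^3" and Z :: "real^3 \<Rightarrow> real^3"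
  assumes chart: "local_parametrization M U X" and u: "u \<in> U"
    and Z: "(Z has_derivative K) (at (X u))" "Z (X u) = 0"
    and K: "\<And>h. h \<noteq> 0 \<Longrightarrow> K (frechet_derivative X (at u) h) \<bullet> frechet_derivative X (at u) h > 0"
  shows "\<exists>r>0. \<forall>v\<in>ball u r - {u}. Z (X v) \<bullet> frechet_derivative X (at v) (v - u) > 0"
proof -
  let ?L = "\<lambda>v. frechet_derivative X (at v)"
  let ?A = "\<lambda>h. K (?L u h)"
  have AD: "((\<lambda>v. Z (X v)) has_derivative ?A) (at u)"
    by (rule has_derivative_compose[OF chart_derivative[OF chart u] Z(1)])
  have bl: "bounded_linear ?A" "bounded_linear (?L u)"
    using AD chart_derivative[OF chart u] by (auto dest: has_derivative_bounded_linear)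
  obtain C where C: "C > 0" "\<And>h. norm (?A h) \<le> norm h * C"
    using bounded_linear.pos_bounded[OF bl(1)] by blast
  obtain C' where C': "C' > 0" "\<And>h. norm (?L u h) \<le> norm h * C'"
    using bounded_linear.pos_bounded[OF bl(2)] by blast
  have "continuous_on (sphere 0 1) (\<lambda>h. ?A h \<bullet> ?L u h)"
    using bl by (intro continuous_on_inner linear_continuous_on)
  then obtain h0 :: complex where h0: "h0 \<in> sphere 0 1"
      "\<And>h. h \<in> sphere 0 1 \<Longrightarrow> ?A h0 \<bullet> ?L u h0 \<le> ?A h \<bullet> ?L u h"
    using continuous_attains_inf[of "sphere (0::complex) 1" "\<lambda>h. ?A h \<bullet> ?L u h"] by auto
  define m where "m = ?A h0 \<bullet> ?L u h0"
  have "h0 \<noteq> 0" using h0(1) by auto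
  then have m: "m > 0" unfolding m_def by (rule K)
  have quad: "m * (norm h)\<^sup>2 \<le> ?A h \<bullet> ?L u h" for h
  proof (cases "h = 0")
    case False
    have lin: "linear ?A" "linear (?L u)" using bl by (simp_all add: bounded_linear.linear)
    have h: "h = norm h *\<^sub>R sgn h" using False by (simp add: sgn_div_norm)
    have "m \<le> ?A (sgn h) \<bullet> ?L u (sgn h)"
      unfolding m_def by (rule h0(2)) (use False in \<open>simp add: norm_sgn\<close>)
    then have "m * (norm h)\<^sup>2 \<le> (?A (sgn h) \<bullet> ?L u (sgn h)) * (norm h)\<^sup>2"
      by (intro mult_right_mono) auto
    also have "\<dots> = ?A (norm h *\<^sub>R sgn h) \<bullet> ?L u (norm h *\<^sub>R sgn h)"
      using linear_cmul[OF lin(1)] linear_cmul[OF lin(2)] by (simp add: power2_eq_square)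
    finally show ?thesis using h by simp
  qed (use linear_0[OF bounded_linear.linear[OF bl(1)]] in simp)
  define D where "D = C + C' + 1"
  have D: "D > 0" using C(1) C'(1) by (simp add: D_def)
  \<comment> \<open>Small enough for the three error terms together to stay below \<open>m * (norm h)\<^sup>2\<close>; the bound 1 absorbs the product of the two errors.\<close>
  define \<eta> where "\<eta> = min 1 (m / (2 * D))"
  have \<eta>: "\<eta> > 0" "\<eta> \<le> 1" using m D by (auto simp: \<eta>_def)
  have "\<eta> * D \<le> m / (2 * D) * D"
    using D by (intro mult_right_mono) (auto simp: \<eta>_def)
  also have "\<dots> = m / 2" using D by simp
  finally have \<eta>m: "\<eta> * (C + C' + 1) < m" using m by (simp add: D_def)
  obtain r1 where r1: "r1 > 0"
    "\<And>v. norm (v - u) < r1 \<Longrightarrow> norm (Z (X v) - Z (X u) - ?A (v - u)) \<le> \<eta> * norm (v - u)"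
    using AD \<eta>(1) unfolding has_derivative_at_alt by blast
  have cont: "isCont (\<lambda>v. ?L v w) u" for w
    using chart_derivative_continuous[OF chart] chart_open[OF chart] u
      continuous_on_eq_continuous_at by blast
  obtain r2 where r2: "r2 > 0" "\<And>v. dist v u < r2 \<Longrightarrow> norm (?L v 1 - ?L u 1) < \<eta> / 2"
    using cont[of 1] \<eta>(1) unfolding continuous_at_eps_delta dist_norm by (metis half_gt_zero)
  obtain r3 where r3: "r3 > 0" "\<And>v. dist v u < r3 \<Longrightarrow> norm (?L v \<i> - ?L u \<i>) < \<eta> / 2"
    using cont[of \<i>] \<eta>(1) unfolding continuous_at_eps_delta dist_norm by (metis half_gt_zero)
  obtain r4 where r4: "r4 > 0" "ball u r4 \<subseteq> U"
    using chart_open[OF chart] u open_contains_ball by blast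
  define r where "r = min (min r1 r2) (min r3 r4)"
  have "Z (X v) \<bullet> ?L v (v - u) > 0" if v: "v \<in> ball u r - {u}" for v
  proof -
    define h where "h = v - u"
    have d: "dist v u < r1" "dist v u < r2" "dist v u < r3" "v \<in> U" and hnz: "h \<noteq> 0"
      using v r4(2) by (auto simp: r_def h_def dist_commute)
    define a where "a = Z (X v) - ?A h"
    define b where "b = ?L v h - ?L u h"
    have a: "norm a \<le> \<eta> * norm h"
      using r1(2)[of v] d(1) Z(2) by (simp add: a_def h_def dist_norm)
    have "b = Re h *\<^sub>R (?L v 1 - ?L u 1) + Im h *\<^sub>R (?L v \<i> - ?L u \<i>)"
      unfolding b_def
      using linear_complex_expand[OF chart_linear[OF chart d(4)], of h]
        linear_complex_expand[OF chart_linear[OF chart u], of h]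
      by (simp add: algebra_simps)
    then have "norm b \<le> \<bar>Re h\<bar> * norm (?L v 1 - ?L u 1) + \<bar>Im h\<bar> * norm (?L v \<i> - ?L u \<i>)"
      by (metis norm_scaleR norm_triangle_ineq)
    also have "\<dots> \<le> norm h * (\<eta> / 2) + norm h * (\<eta> / 2)"
      using r2(2)[OF d(2)] r3(2)[OF d(3)]
      by (intro add_mono mult_mono abs_Re_le_cmod abs_Im_le_cmod) auto
    finally have b: "norm b \<le> \<eta> * norm h" by simp
    have "Z (X v) \<bullet> ?L v h = (?A h + a) \<bullet> (?L u h + b)"
      by (simp add: a_def b_def)
    also have "\<dots> = ?A h \<bullet> ?L u h + (?A h \<bullet> b + a \<bullet> ?L u h + a \<bullet> b)"
      by (simp add: inner_add_left inner_add_right)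
    also have "\<dots> \<ge> m * (norm h)\<^sup>2 - (\<eta> * (C + C' + 1)) * (norm h)\<^sup>2"
    proof -
      have "\<bar>?A h \<bullet> b\<bar> \<le> (norm h * C) * (\<eta> * norm h)"
        using Cauchy_Schwarz_ineq2[of "?A h" b] mult_mono[OF C(2)[of h] b] C(1) by simp
      moreover have "\<bar>a \<bullet> ?L u h\<bar> \<le> (\<eta> * norm h) * (norm h * C')"
        using Cauchy_Schwarz_ineq2[of a "?L u h"] mult_mono[OF a C'(2)[of h]] \<eta>(1) by simp
      moreover have "\<bar>a \<bullet> b\<bar> \<le> (\<eta> * norm h) * (1 * norm h)"
        using Cauchy_Schwarz_ineq2[of a b] mult_mono[OF a order_trans[OF b mult_right_mono[OF \<eta>(2)]]] \<eta>(1) by simp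
      ultimately have "\<bar>?A h \<bullet> b + a \<bullet> ?L u h + a \<bullet> b\<bar> \<le> (\<eta> * (C + C' + 1)) * (norm h)\<^sup>2"
        by (simp add: algebra_simps power2_eq_square)
      then show ?thesis using quad[of h] by linarith
    qed
    finally have "(m - \<eta> * (C + C' + 1)) * (norm h)\<^sup>2 \<le> Z (X v) \<bullet> ?L v h"
      by (simp add: left_diff_distrib)
    moreover have "(m - \<eta> * (C + C' + 1)) * (norm h)\<^sup>2 > 0"
      using \<eta>m hnz by simp
    ultimately show ?thesis by (simp add: h_def)
  qed
  moreover have "r > 0" using r1 r2 r3 r4 by (simp add: r_def)
  ultimately show ?thesis by blast
qed

context level_surface
begin

text \<open>
  In the chart, let \<open>z\<close> and \<open>m\<close>
  represent \<open>Z\<close> and the major vector built from \<open>Z\<close>. Neither \<open>m / z\<close> nor \<open>z / (v - u)\<close> is ever a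
  nonpositive real, so the principal arguments of these quotients are continuous on the whole
  punctured ball. Adding them to a continuous argument of the loop about \<open>u\<close> yields an angle function of \<open>m\<close>
  whose total change is that of the loop itself.
\<close>

lemma umbilic_index_one:
  fixes Z :: "real^3 \<Rightarrow> real^3"
  assumes iso: "p isolated_in umbilic_points M"
    and V: "open V" "p \<in> V" and Z_cont: "continuous_on V Z"
    and Z_deriv: "(Z has_derivative K) (at p)" and Z_zero: "Z p = 0"
    and K: "\<And>w. grad p \<bullet> w = 0 \<Longrightarrow> w \<noteq> 0 \<Longrightarrow> K w \<bullet> w > 0"
    and Z_tangent: "\<And>q. q \<in> M \<inter> V - {p} \<Longrightarrow> grad q \<bullet> Z q = 0"
    and Z_nonprincipal: "\<And>q. q \<in> M \<inter> V - {p} \<Longrightarrow> hess q (Z q) \<bullet> cross3 (grad q) (Z q) \<noteq> 0"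
  shows "has_umbilic_index M p 1"
  unfolding has_umbilic_index_def
proof (intro conjI iso allI impI)
  fix U X u assume *: "local_parametrization M U X \<and> u \<in> U \<and> X u = p"
  then have chart: "local_parametrization M U X" and u: "u \<in> U" and Xu: "X u = p" by auto
  let ?L = "\<lambda>v. frechet_derivative X (at v)"
  obtain r1 \<sigma> where r1: "r1 > 0" "ball u r1 \<subseteq> U" and \<sigma>: "\<sigma> = 1 \<or> \<sigma> = (-1::real)"
    and normal: "\<And>v. v \<in> ball u r1 \<Longrightarrow> unit_normal X v = \<sigma> *\<^sub>R sgn (grad (X v))"
    using unit_normal_eq_sgn_grad[OF chart u] by metis
  have "K (?L u h) \<bullet> ?L u h > 0" if "h \<noteq> 0" for h
  proof (rule K)
    show "grad p \<bullet> ?L u h = 0" using chart_tangent[OF chart u] Xu by simp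
    show "?L u h \<noteq> 0"
      using chart_inj[OF chart u] chart_linear[OF chart u] linear_injective_0 that by blast
  qed
  then obtain r2 where r2: "r2 > 0"
    "\<And>v. v \<in> ball u r2 - {u} \<Longrightarrow> Z (X v) \<bullet> ?L v (v - u) > 0"
    using outward_field_along_chart[OF chart u, of Z K] Z_deriv Z_zero Xu by auto
  \<comment> \<open>Small enough for a constant sign of the normal, for the outward estimate, and for \<open>Z\<close> to be defined along the chart.\<close>
  have "open (U \<inter> X -` V)"
    by (intro continuous_open_preimage chart_continuous[OF chart] chart_open[OF chart] V(1))
  then obtain r3 where r3: "r3 > 0" "ball u r3 \<subseteq> U \<inter> X -` V"
    using u Xu V(2) open_contains_ball by blast
  define r where "r = min r1 (min r2 r3)"
  define S where "S = ball u r - {u}"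
  have SU: "S \<subseteq> U" using r1 by (auto simp: S_def r_def)
  have XS: "X v \<in> M \<inter> V - {p}" if "v \<in> S" for v
  proof -
    have "v \<in> U" "v \<noteq> u" using that SU by (auto simp: S_def)
    then have "X v \<noteq> p" using chart_inj_on[OF chart] u Xu by (auto dest: inj_onD)
    moreover have "X v \<in> V" using that r3(2) by (auto simp: S_def r_def)
    ultimately show ?thesis using chart_mem[OF chart \<open>v \<in> U\<close>] by blast
  qed
  define \<kappa> where "\<kappa> v = - (\<sigma> / norm (grad (X v)))" for v
  define w where "w v = major_tangent (\<kappa> v) (X v) (Z (X v))" for v
  define z where "z v = chart_coords X v (Z (X v))" for v
  define m where "m v = chart_coords X v (w v)" for v
  have X_cont: "continuous_on S X"
    using chart_continuous[OF chart] SU continuous_on_subset by blast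
  have ZX_cont: "continuous_on S (\<lambda>v. Z (X v))"
    by (rule continuous_on_compose2[OF Z_cont X_cont]) (use XS in auto)
  have \<kappa>_cont: "continuous_on S \<kappa>"
    unfolding \<kappa>_def[abs_def]
    by (intro continuous_intros continuous_on_compose2[OF grad_continuous X_cont])
      (use XS grad_nonzero in auto)
  have z_cont: "continuous_on S z"
    unfolding z_def[abs_def] by (rule chart_coords_continuous[OF chart SU ZX_cont])
  have "continuous_on S w"
    unfolding w_def[abs_def]
    by (rule major_tangent_continuous[OF \<kappa>_cont X_cont ZX_cont]) (use XS in auto)
  then have m_cont: "continuous_on S m"
    unfolding m_def[abs_def] by (rule chart_coords_continuous[OF chart SU])
  have coords: "?L v (chart_coords X v x) = x" if v: "v \<in> S" and x: "grad (X v) \<bullet> x = 0" for v x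
  proof -
    have "v \<in> U" using v SU by blast
    then obtain y where "x = ?L v y"
      using x tangent_plane_eq[OF chart] by (auto simp: tangent_plane_def)
    then show ?thesis using chart_coords_derivative[OF chart \<open>v \<in> U\<close>] by simp
  qed
  have tan_Z: "grad (X v) \<bullet> Z (X v) = 0" if "v \<in> S" for v
    using Z_tangent XS that by blast
  have \<kappa>_nz: "\<kappa> v \<noteq> 0" if "v \<in> S" for v
    using \<sigma> XS[OF that] grad_nonzero by (auto simp: \<kappa>_def)
  have Lz: "?L v (z v) = Z (X v)" if "v \<in> S" for v
    unfolding z_def by (rule coords[OF that tan_Z[OF that]])
  have Lm: "?L v (m v) = w v" if "v \<in> S" for v
    unfolding m_def
  proof (rule coords[OF that])
    have "grad (X v) \<bullet> cross3 (sgn (grad (X v))) x = 0" for x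
      by (simp add: sgn_div_norm cross_mult_left dot_cross_self)
    then show "grad (X v) \<bullet> w v = 0"
      using tan_Z[OF that] by (simp add: w_def major_tangent_def Let_def inner_add_right)
  qed
  have wz: "w v \<bullet> Z (X v) > 0" if "v \<in> S" for v
    unfolding w_def by (rule major_tangent_inner[OF \<kappa>_nz[OF that] Z_nonprincipal[OF XS[OF that]]])
  have lin: "linear (?L v)" if "v \<in> S" for v
    using that SU chart_linear[OF chart] by blast
  have z_nz: "z v \<noteq> 0" and m_nz: "m v \<noteq> 0" if "v \<in> S" for v
    using wz[OF that] Lz[OF that] Lm[OF that] linear_0[OF lin[OF that]] by auto
  have m_z: "m v / z v \<notin> \<real>\<^sub>\<le>\<^sub>0" if "v \<in> S" for v
  proof
    assume "m v / z v \<in> \<real>\<^sub>\<le>\<^sub>0"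
    then obtain c where c: "c \<le> 0" "m v / z v = of_real c" by (auto elim: nonpos_Reals_cases)
    then have "m v = c *\<^sub>R z v" using z_nz[OF that] by (simp add: field_simps scaleR_conv_of_real)
    then have "w v = c *\<^sub>R Z (X v)"
      using Lm[OF that] Lz[OF that] linear_cmul[OF lin[OF that]] by metis
    then have "w v \<bullet> Z (X v) \<le> 0" using c(1) by (simp add: mult_nonpos_nonneg)
    with wz[OF that] show False by simp
  qed
  have z_u: "z v / (v - u) \<notin> \<real>\<^sub>\<le>\<^sub>0" if "v \<in> S" for v
  proof
    assume "z v / (v - u) \<in> \<real>\<^sub>\<le>\<^sub>0"
    then obtain c where c: "c \<le> 0" "z v / (v - u) = of_real c" by (auto elim: nonpos_Reals_cases)
    moreover have "v - u \<noteq> 0" using that by (simp add: S_def)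
    ultimately have "z v = c *\<^sub>R (v - u)" by (simp add: field_simps scaleR_conv_of_real)
    then have "Z (X v) = c *\<^sub>R ?L v (v - u)"
      using Lz[OF that] linear_cmul[OF lin[OF that]] by metis
    then have "Z (X v) \<bullet> ?L v (v - u) \<le> 0" using c(1) by (simp add: mult_nonpos_nonneg)
    with r2(2)[of v] that show False by (auto simp: S_def r_def)
  qed
  show "\<exists>r>0. \<forall>\<gamma>. simple_path \<gamma> \<and> pathfinish \<gamma> = pathstart \<gamma> \<and>
      path_image \<gamma> \<subseteq> ball u r - {u} \<and> winding_number \<gamma> u = 1 \<longrightarrow>
      (\<exists>\<theta>. continuous_on {0..1} \<theta> \<and> (\<forall>t\<in>{0..1}. major_direction X (\<gamma> t) (cis (\<theta> t))) \<and>
        1 = (\<theta> 1 - \<theta> 0) / (2 * pi))"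
  proof (intro exI[of _ r] conjI allI impI)
    show "r > 0" using r1 r2 r3 by (simp add: r_def)
    fix \<gamma> assume \<gamma>: "simple_path \<gamma> \<and> pathfinish \<gamma> = pathstart \<gamma> \<and>
      path_image \<gamma> \<subseteq> ball u r - {u} \<and> winding_number \<gamma> u = 1"
    then have path: "path \<gamma>" and "u \<notin> path_image \<gamma>" by (auto simp: simple_path_imp_path)
    then obtain q where q: "path q"
      "pathfinish q - pathstart q = 2 * of_real pi * \<i> * winding_number \<gamma> u"
      "\<And>t. t \<in> {0..1} \<Longrightarrow> \<gamma> t = u + exp (q t)"
      using winding_number_as_continuous_log by metis
    have \<gamma>S: "\<gamma> t \<in> S" if "t \<in> {0..1}" for t
      using \<gamma> that unfolding S_def path_image_def by blast
    have \<gamma>_cont: "continuous_on {0..1} \<gamma>" using path by (simp add: path_def)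
    have comp: "continuous_on {0..1} (\<lambda>t. f (\<gamma> t))" if "continuous_on S f" for f :: "complex \<Rightarrow> complex"
      by (rule continuous_on_compose2[OF that \<gamma>_cont]) (use \<gamma>S in auto)
    \<comment> \<open>The argument of the telescoping product \<open>(v - u) * (z v / (v - u)) * (m v / z v) = m v\<close> at \<open>v = \<gamma> t\<close>.\<close>
    define \<theta> where "\<theta> t = Im (q t) + Arg (z (\<gamma> t) / (\<gamma> t - u)) + Arg (m (\<gamma> t) / z (\<gamma> t))" for t
    have "continuous_on {0..1} \<theta>"
    proof -
      have "continuous_on {0..1} q" using q(1) by (simp add: path_def)
      moreover have "\<gamma> t - u \<noteq> 0" if "t \<in> {0..1}" for t
        using \<gamma>S[OF that] by (simp add: S_def)
      ultimately show ?thesis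
        unfolding \<theta>_def[abs_def]
        by (intro continuous_intros comp z_cont m_cont \<gamma>_cont) (use z_u m_z z_nz \<gamma>S in auto)
    qed
    moreover have "major_direction X (\<gamma> t) (cis (\<theta> t))" if t: "t \<in> {0..1}" for t
    proof -
      define v where "v = \<gamma> t"
      have v: "v \<in> S" using \<gamma>S[OF t] by (simp add: v_def)
      then have vu: "v - u \<noteq> 0" by (simp add: S_def)
      have "sgn (v - u) = cis (Im (q t))"
        using q(3)[OF t] by (simp add: v_def exp_eq_polar sgn_mult sgn_of_real)
      moreover have "cis (Arg (z v / (v - u))) = sgn (z v / (v - u))"
        "cis (Arg (m v / z v)) = sgn (m v / z v)"
        using z_nz[OF v] m_nz[OF v] vu by (simp_all add: cis_Arg)
      ultimately have "cis (\<theta> t) = sgn (v - u) * sgn (z v / (v - u)) * sgn (m v / z v)"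
        by (simp add: \<theta>_def v_def flip: cis_mult)
      also have "\<dots> = sgn (m v)"
        unfolding sgn_mult[symmetric] using z_nz[OF v] vu by simp
      finally have cis: "cis (\<theta> t) = inverse (norm (m v)) *\<^sub>R m v"
        by (simp add: sgn_div_norm)
      have vU: "v \<in> U" and vb: "v \<in> ball u r1" using v SU by (auto simp: S_def r_def)
      have "\<sigma> \<noteq> 0" using \<sigma> by auto
      show ?thesis unfolding v_def[symmetric] cis
        by (rule major_direction_major_tangent[OF chart vU open_ball vb normal \<open>\<sigma> \<noteq> 0\<close>
              tan_Z[OF v] Z_nonprincipal[OF XS[OF v]], where r = "inverse (norm (m v))"])
          (use Lm[OF v] m_nz[OF v] in \<open>simp_all add: linear_cmul[OF lin[OF v]] w_def \<kappa>_def\<close>)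
    qed
    moreover have "1 = (\<theta> 1 - \<theta> 0) / (2 * pi)"
    proof -
      have "\<gamma> 1 = \<gamma> 0" using \<gamma> by (simp add: pathfinish_def pathstart_def)
      then have "\<theta> 1 - \<theta> 0 = Im (q 1 - q 0)" by (simp add: \<theta>_def)
      also have "q 1 - q 0 = 2 * of_real pi * \<i>"
        using q(2) \<gamma> by (simp add: pathfinish_def pathstart_def)
      finally show ?thesis by simp
    qed
    ultimately show "\<exists>\<theta>. continuous_on {0..1} \<theta> \<and>
        (\<forall>t\<in>{0..1}. major_direction X (\<gamma> t) (cis (\<theta> t))) \<and> 1 = (\<theta> 1 - \<theta> 0) / (2 * pi)"
      by blast
  qed
qed

end

section \<open>Separable quartic surfaces\<close>

lemma Ck_on_power:
  fixes f :: "'a::euclidean_space \<Rightarrow> real"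
  assumes "open U" "Ck_on n U f"
  shows "Ck_on n U (\<lambda>x. f x ^ m)"
  by (induction m) (simp_all add: Ck_on_const Ck_on_mult assms)

lemma has_derivative_vecI:
  fixes f :: "'a::real_normed_vector \<Rightarrow> real ^ 'n"
  assumes "\<And>i. ((\<lambda>x. f x $ i) has_derivative (\<lambda>h. f' h $ i)) (at a)"
  shows "(f has_derivative f') (at a)"
  using assms unfolding has_derivative_componentwise_within[of f]
  by (auto simp: Basis_vec_def inner_axis)

lemma has_derivative_vec_component:
  "((\<lambda>x :: real ^ 'n. x $ i) has_derivative (\<lambda>h. h $ i)) (at a)"
  by (rule bounded_linear_imp_has_derivative[OF bounded_linear_vec_nth])

definition quartic :: "real^3 \<Rightarrow> real^3 \<Rightarrow> real^3 \<Rightarrow> real" where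
  "quartic A E p = (\<Sum>i\<in>UNIV. A$i * (p$i)^2 + E$i * (p$i)^4)"

definition quartic_grad :: "real^3 \<Rightarrow> real^3 \<Rightarrow> real^3 \<Rightarrow> real^3" where
  "quartic_grad A E p = (\<chi> i. 2 * p$i * (A$i + 2 * E$i * (p$i)^2))"

definition quartic_hess :: "real^3 \<Rightarrow> real^3 \<Rightarrow> real^3 \<Rightarrow> real^3 \<Rightarrow> real^3" where
  "quartic_hess A E p w = (\<chi> i. (2 * A$i + 12 * E$i * (p$i)^2) * w$i)"

definition quartic_surface :: "real^3 \<Rightarrow> real^3 \<Rightarrow> (real^3) set" where
  "quartic_surface A E = {p. quartic A E p = 1}"

text \<open>
  The gradient is nonzero on the surface since its \<open>i\<close>-th component vanishes only with \<open>p $ i\<close>,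
  and the origin is not on the surface.
\<close>

lemma quartic_level_surface:
  assumes A: "\<And>i. A$i > 0" and E: "\<And>i. E$i \<ge> 0"
  shows "level_surface (quartic A E) (quartic_grad A E) (quartic_hess A E) 1 (quartic_surface A E)"
proof
  show "quartic_surface A E = {p. quartic A E p = 1}" by (rule quartic_surface_def)
  fix p :: "real^3"
  show "(quartic A E has_derivative (\<lambda>v. quartic_grad A E p \<bullet> v)) (at p)"
  proof -
    have "((\<lambda>q. \<Sum>i\<in>UNIV. A$i * (q$i)^2 + E$i * (q$i)^4) has_derivative
        (\<lambda>v. \<Sum>i\<in>UNIV. quartic_grad A E p $ i * v $ i)) (at p)"
      by (auto intro!: derivative_eq_intros has_derivative_vec_component
          simp: quartic_grad_def algebra_simps power2_eq_square power3_eq_cube)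
    then show ?thesis by (simp add: quartic_def[abs_def] inner_vec_def)
  qed
  show "(quartic_grad A E has_derivative quartic_hess A E p) (at p)"
    by (rule has_derivative_vecI)
      (auto intro!: derivative_eq_intros has_derivative_vec_component
        simp: quartic_grad_def quartic_hess_def algebra_simps power2_eq_square)
  show "quartic_grad A E p \<noteq> 0" if "p \<in> quartic_surface A E"
  proof
    assume "quartic_grad A E p = 0"
    then have "2 * p$i * (A$i + 2 * E$i * (p$i)^2) = 0" for i
      by (simp add: quartic_grad_def vec_eq_iff)
    moreover have "A$i + 2 * E$i * (p$i)^2 > 0" for i
      using A[of i] E[of i] by (intro add_pos_nonneg mult_nonneg_nonneg) auto
    ultimately have "p$i = 0" for i
      by (metis less_irrefl mult_eq_0_iff zero_neq_numeral)
    then have "quartic A E p = 0" by (simp add: quartic_def)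
    with that show False by (simp add: quartic_surface_def)
  qed
  show "continuous_on UNIV (\<lambda>(p, w). quartic_hess A E p w)"
    unfolding quartic_hess_def case_prod_unfold
    by (intro continuous_intros continuous_on_vec_lambda)
  show "quartic_hess A E p v \<bullet> w = quartic_hess A E p w \<bullet> v" for v w
    by (simp add: quartic_hess_def inner_vec_def mult_ac)
qed

text \<open>
  The positive solution \<open>t\<close> of \<open>\<alpha> t\<^sup>2 + \<epsilon> t\<^sup>4 = c\<close>, in a form that remains valid for \<open>\<epsilon> = 0\<close>
  and so covers the quadratic coordinate as well.
\<close>

definition quartic_root :: "real \<Rightarrow> real \<Rightarrow> real \<Rightarrow> real" where
  "quartic_root \<alpha> \<epsilon> c = sqrt (2 * c / (\<alpha> + sqrt (\<alpha>^2 + 4 * \<epsilon> * c)))"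

lemma quartic_root:
  assumes "\<alpha> > 0" "\<epsilon> \<ge> 0" "c > 0"
  shows "quartic_root \<alpha> \<epsilon> c > 0"
    and "\<alpha> * (quartic_root \<alpha> \<epsilon> c)^2 + \<epsilon> * (quartic_root \<alpha> \<epsilon> c)^4 = c"
proof -
  define r where "r = sqrt (\<alpha>^2 + 4 * \<epsilon> * c)"
  have r2: "r^2 = \<alpha>^2 + 4 * \<epsilon> * c" and r: "r \<ge> 0" using assms by (simp_all add: r_def)
  have pos: "\<alpha> + r > 0" using assms r by simp
  show "quartic_root \<alpha> \<epsilon> c > 0"
    using pos assms by (simp add: quartic_root_def flip: r_def)
  have q2: "(quartic_root \<alpha> \<epsilon> c)^2 = 2 * c / (\<alpha> + r)"
    using pos assms by (simp add: quartic_root_def flip: r_def)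
  have "(quartic_root \<alpha> \<epsilon> c)^4 = (2 * c / (\<alpha> + r))^2" by (simp flip: q2)
  moreover have "\<alpha> * (2 * c / w) + \<epsilon> * (2 * c / w)^2 = (2 * \<alpha> * c * w + 4 * \<epsilon> * c^2) / w^2"
    if "w > 0" for w
    using that by (simp add: field_simps power2_eq_square)
  ultimately have "\<alpha> * (quartic_root \<alpha> \<epsilon> c)^2 + \<epsilon> * (quartic_root \<alpha> \<epsilon> c)^4 =
      (2 * \<alpha> * c * (\<alpha> + r) + 4 * \<epsilon> * c^2) / (\<alpha> + r)^2"
    using q2 pos by metis
  also have "2 * \<alpha> * c * (\<alpha> + r) + 4 * \<epsilon> * c^2 = c * (\<alpha> + r)^2"
    using r2 by (simp add: power2_eq_square algebra_simps)
  finally show "\<alpha> * (quartic_root \<alpha> \<epsilon> c)^2 + \<epsilon> * (quartic_root \<alpha> \<epsilon> c)^4 = c"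
    using pos by simp
qed

lemma quartic_root_unique:
  assumes "\<alpha> > 0" "\<epsilon> \<ge> 0" "t > 0"
  shows "quartic_root \<alpha> \<epsilon> (\<alpha> * t^2 + \<epsilon> * t^4) = t"
proof -
  have pos: "\<alpha> + \<epsilon> * t^2 > 0" using assms by (simp add: add_pos_nonneg)
  have "sqrt (\<alpha>^2 + 4 * \<epsilon> * (\<alpha> * t^2 + \<epsilon> * t^4)) = \<alpha> + 2 * \<epsilon> * t^2"
    by (rule real_sqrt_unique) (use assms in \<open>simp_all add: power2_eq_square power4_eq_xxxx algebra_simps\<close>)
  moreover have "2 * (\<alpha> * t^2 + \<epsilon> * t^4) / (\<alpha> + (\<alpha> + 2 * \<epsilon> * t^2)) = t^2"
  proof -
    have "2 * (\<alpha> * t^2 + \<epsilon> * t^4) = t^2 * (\<alpha> + (\<alpha> + 2 * \<epsilon> * t^2))"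
      by (simp add: algebra_simps power2_eq_square power4_eq_xxxx)
    then show ?thesis using pos by simp
  qed
  ultimately show ?thesis using assms(3) by (simp add: quartic_root_def)
qed

lemma ex_other_indices:
  obtains j k :: 3 where "i \<noteq> j" "i \<noteq> k" "j \<noteq> k" "UNIV = {i, j, k}"
proof -
  have "UNIV = {1, 2, 3::3}" "(1::3) \<noteq> 2" "(1::3) \<noteq> 3" "(2::3) \<noteq> 3"
    using UNIV_3 by auto
  moreover have "i = 1 \<or> i = 2 \<or> i = 3" by (rule exhaust_3)
  ultimately show thesis using that[of 2 3] that[of 1 3] that[of 1 2] by (auto simp: insert_commute)
qed

text \<open>
  Some coordinate \<open>i\<close> of \<open>p\<close> is nonzero. On the half space where this coordinate has
  the sign it has at \<open>p\<close>, the surface is the graph of a function of the other two coordinates, by solving the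
  separated equation for it. Projecting to these two coordinates inverts the chart, also
  at the level of differentials.
\<close>

lemma quartic_chart_exists:
  assumes A: "\<And>i. A$i > 0" and E: "\<And>i. E$i \<ge> 0" and p: "p \<in> quartic_surface A E"
  shows "\<exists>U X. local_parametrization (quartic_surface A E) U X \<and> p \<in> X ` U"
proof -
  have "p \<noteq> 0" using p by (auto simp: quartic_surface_def quartic_def)
  then obtain i where i: "p$i \<noteq> 0" by (auto simp: vec_eq_iff)
  obtain j k where ijk: "i \<noteq> j" "i \<noteq> k" "j \<noteq> k" "UNIV = {i, j, k}" by (rule ex_other_indices)
  define g where "g l t = A$l * t^2 + E$l * t^4" for l t
  \<comment> \<open>The equation \<open>g i t = c u\<close> remains for the coordinate \<open>i\<close>; the difference is written as a sum, as sums and products preserve smoothness.\<close>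
  define c where "c u = 1 + (-1) * (g j (Re u) + g k (Im u))" for u
  define U where "U = {u. c u > 0}"
  define s where "s = sgn (p$i)"
  define X :: "complex \<Rightarrow> real^3" where
    "X u = (\<chi> l. if l = i then s * quartic_root (A$i) (E$i) (c u) else if l = j then Re u else Im u)" for u
  define Y :: "real^3 \<Rightarrow> complex" where "Y q = Complex (q$j) (q$k)" for q
  have s: "s * s = 1" "\<bar>s\<bar> = 1" "s \<noteq> 0" using i by (auto simp: s_def sgn_real_def)
  have s24: "s^2 = 1" "s^4 = 1" using s by (simp_all add: power2_eq_square power4_eq_xxxx)
  have Xi: "X u $ i = s * quartic_root (A$i) (E$i) (c u)" and Xj: "X u $ j = Re u" and Xk: "X u $ k = Im u" for u
    using ijk by (simp_all add: X_def)
  have YX: "Y (X u) = u" for u by (simp add: Y_def Xj Xk)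
  have quartic_eq: "quartic A E q = g i (q$i) + g j (q$j) + g k (q$k)" for q
    unfolding quartic_def ijk(4) using ijk(1-3) by (simp add: g_def)
  have c_cont: "continuous_on UNIV c"
    unfolding c_def g_def by (intro continuous_intros)
  have U: "open U"
    unfolding U_def by (intro open_Collect_less continuous_intros c_cont)
  have Ck_g: "Ck_on n U (\<lambda>u. g l (f u))" if "Ck_on n U f" for n l f
    unfolding g_def by (intro Ck_on_add Ck_on_mult Ck_on_power Ck_on_const U that)
  have Ck_ReIm: "Ck_on n U Re" "Ck_on n U Im" for n
    by (intro Ck_on_bounded_linear U bounded_linear_Re bounded_linear_Im)+
  have Ck_c: "Ck_on n U c" for n
    unfolding c_def by (intro Ck_on_add Ck_on_mult Ck_on_const U Ck_g Ck_ReIm)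
  have c_pos: "c u > 0" if "u \<in> U" for u using that by (simp add: U_def)
  have rad: "(A$i)^2 + 4 * E$i * c u > 0" "A$i + sqrt ((A$i)^2 + 4 * E$i * c u) > 0" if "u \<in> U" for u
    using A[of i] E[of i] c_pos[OF that] by (simp_all add: add_pos_nonneg)
  have Ck_root: "Ck_on n U (\<lambda>u. quartic_root (A$i) (E$i) (c u))" for n
    unfolding quartic_root_def
    by (intro Ck_on_sqrt Ck_on_divide Ck_on_add Ck_on_mult Ck_on_const Ck_c U)
      (use rad c_pos in auto)
  have smooth: "Ck_on n U X" for n
  proof (rule Ck_on_vec[OF U])
    fix l
    consider "l = i" | "l = j" | "l = k" using ijk(4) by blast
    then show "Ck_on n U (\<lambda>u. X u $ l)"
      by cases (simp_all add: Xi Xj Xk Ck_ReIm Ck_on_mult Ck_on_const Ck_root U)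
  qed
  have inj: "inj (frechet_derivative X (at u))" if "u \<in> U" for u
  proof -
    have blY: "bounded_linear Y"
      unfolding Y_def Complex_eq by (intro bounded_linear_intros bounded_linear_compose[OF bounded_linear_of_real] bounded_linear_vec_nth)
    have "((\<lambda>u. Y (X u)) has_derivative (\<lambda>v. Y (frechet_derivative X (at u) v))) (at u)"
      by (rule bounded_linear.has_derivative[OF blY Ck_on_SucD(1)[OF smooth[of "Suc 0"] that]])
    then have "(\<lambda>v. Y (frechet_derivative X (at u) v)) = (\<lambda>v. v)"
      unfolding YX using has_derivative_unique has_derivative_ident by blast
    then show ?thesis by (metis injI)
  qed
  have image: "X ` U = quartic_surface A E \<inter> {q. s * q$i > 0}"
  proof (intro equalityI subsetI)
    fix q assume "q \<in> X ` U"
    then obtain u where u: "u \<in> U" "q = X u" by blast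
    note root = quartic_root[OF A[of i] E[of i] c_pos[OF u(1)]]
    have "g i (q$i) = c u"
      using root(2) s24 by (simp add: u(2) Xi g_def power_mult_distrib)
    then have "quartic A E q = 1"
      by (simp add: quartic_eq c_def u(2) Xj Xk)
    moreover have "s * q$i > 0"
      using root(1) s(1) by (simp add: u(2) Xi flip: mult.assoc)
    ultimately show "q \<in> quartic_surface A E \<inter> {q. s * q$i > 0}"
      by (simp add: quartic_surface_def)
  next
    fix q assume "q \<in> quartic_surface A E \<inter> {q. s * q$i > 0}"
    then have q: "quartic A E q = 1" and pos: "s * q$i > 0" by (auto simp: quartic_surface_def)
    have g: "g i (q$i) = c (Y q)"
      using q by (simp add: quartic_eq c_def Y_def)
    have gs: "g i (q$i) = g i (s * q$i)"
      by (simp add: g_def power_mult_distrib s24)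
    have "g i t > 0" if "t > 0" for t
      using A[of i] E[of i] that by (simp add: g_def add_pos_nonneg)
    from this[OF pos]
    have "Y q \<in> U" using g gs by (simp add: U_def)
    moreover have "X (Y q) = q"
    proof -
      have "quartic_root (A$i) (E$i) (c (Y q)) = s * q$i"
        unfolding g[symmetric] gs unfolding g_def by (rule quartic_root_unique[OF A E pos])
      then have "X (Y q) $ l = q $ l" if "l \<in> {i, j, k}" for l
        using that s(1) by (auto simp: Xi Xj Xk Y_def simp flip: mult.assoc)
      then show ?thesis using ijk(4) by (auto simp: vec_eq_iff)
    qed
    ultimately show "q \<in> X ` U" by (metis imageI)
  qed
  have "open {q :: real^3. s * q$i > 0}"
    by (intro open_Collect_less continuous_intros)
  then have "openin (top_of_set (quartic_surface A E)) (X ` U)"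
    unfolding image by (rule openin_open_Int)
  moreover have "homeomorphism U (X ` U) X Y"
    unfolding homeomorphism_def
  proof (intro conjI ballI)
    show "continuous_on U X" using Ck_on_continuous[OF smooth] .
    show "continuous_on (X ` U) Y" unfolding Y_def Complex_eq by (intro continuous_intros)
  qed (auto simp: YX image_iff)
  ultimately have "local_parametrization (quartic_surface A E) U X"
    unfolding local_parametrization_def smooth_on_def using U smooth inj by blast
  moreover have "p \<in> X ` U"
    using p i by (auto simp: image s_def sgn_real_def)
  ultimately show ?thesis by blast
qed

section \<open>The umbilic equations\<close>

lemma cross_cross_left:
  fixes n w :: "real^3"
  assumes "n \<bullet> w = 0"
  shows "cross3 (cross3 n w) n = (n \<bullet> n) *\<^sub>R w"
  using cross_skew[of "cross3 n w" n] assms by (simp add: Lagrange)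

lemma orthogonal_eq_cross:
  fixes n w :: "real^3"
  assumes "n \<noteq> 0" "n \<bullet> w = 0"
  obtains m where "w = cross3 m n"
proof
  show "w = cross3 ((1 / (n \<bullet> n)) *\<^sub>R cross3 n w) n"
    using assms by (simp add: cross_mult_left cross_cross_left)
qed

text \<open>
  The plane orthogonal to \<open>n\<close> consists of the vectors \<open>m \<times> n\<close>, so both sides of the bilinear
  identity need only be compared on the products of the coordinate vectors with \<open>n\<close>. These six
  comparisons are the equations on the right.
\<close>

lemma diagonal_scalar_on_plane_iff:
  fixes n d :: "real^3"
  assumes "n \<noteq> 0"
  shows "(\<forall>w w'. n \<bullet> w = 0 \<longrightarrow> n \<bullet> w' = 0 \<longrightarrow> (\<chi> i. d$i * w$i) \<bullet> w' = k * (w \<bullet> w')) \<longleftrightarrow>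
    (d$1 - k) * n$2 * n$3 = 0 \<and> (d$2 - k) * n$1 * n$3 = 0 \<and> (d$3 - k) * n$1 * n$2 = 0 \<and>
    (d$2 - k) * (n$3)^2 + (d$3 - k) * (n$2)^2 = 0 \<and>
    (d$1 - k) * (n$3)^2 + (d$3 - k) * (n$1)^2 = 0 \<and>
    (d$1 - k) * (n$2)^2 + (d$2 - k) * (n$1)^2 = 0"
    (is "?L \<longleftrightarrow> ?R")
proof
  assume L: ?L
  define e1 :: "real^3" where "e1 = vector [0, n$3, - n$2]"
  define e2 :: "real^3" where "e2 = vector [n$3, 0, - n$1]"
  define e3 :: "real^3" where "e3 = vector [n$2, - n$1, 0]"
  have orth: "n \<bullet> e1 = 0" "n \<bullet> e2 = 0" "n \<bullet> e3 = 0"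
    by (simp_all add: e1_def e2_def e3_def inner_vec_def sum_3)
  have "(\<chi> i. d$i * e1$i) \<bullet> e2 = k * (e1 \<bullet> e2)" "(\<chi> i. d$i * e1$i) \<bullet> e3 = k * (e1 \<bullet> e3)"
    "(\<chi> i. d$i * e2$i) \<bullet> e3 = k * (e2 \<bullet> e3)" "(\<chi> i. d$i * e1$i) \<bullet> e1 = k * (e1 \<bullet> e1)"
    "(\<chi> i. d$i * e2$i) \<bullet> e2 = k * (e2 \<bullet> e2)" "(\<chi> i. d$i * e3$i) \<bullet> e3 = k * (e3 \<bullet> e3)"
    using L orth by blast+
  then show ?R
    by (simp_all add: e1_def e2_def e3_def inner_vec_def sum_3 algebra_simps power2_eq_square)
next
  assume R: ?R
  show ?L
  proof (intro allI impI)
    fix w w' assume "n \<bullet> w = 0" "n \<bullet> w' = 0"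
    then obtain m m' where m: "w = cross3 m n" and m': "w' = cross3 m' n"
      using orthogonal_eq_cross[OF assms] by metis
    have "(\<chi> i. d$i * w$i) \<bullet> w' - k * (w \<bullet> w') =
      (d$1 - k) * (m$2 * n$3 - n$2 * m$3) * (m'$2 * n$3 - n$2 * m'$3)
      + (d$2 - k) * (m$3 * n$1 - n$3 * m$1) * (m'$3 * n$1 - n$3 * m'$1)
      + (d$3 - k) * (m$1 * n$2 - n$1 * m$2) * (m'$1 * n$2 - n$1 * m'$2)"
      unfolding m m' by (simp add: inner_vec_def sum_3 cross_components algebra_simps)
    also have "\<dots> = m$2 * m'$2 * ((d$1 - k) * (n$3)^2 + (d$3 - k) * (n$1)^2)
      + m$3 * m'$3 * ((d$1 - k) * (n$2)^2 + (d$2 - k) * (n$1)^2)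
      + m$1 * m'$1 * ((d$2 - k) * (n$3)^2 + (d$3 - k) * (n$2)^2)
      - (m$2 * m'$3 + m$3 * m'$2) * ((d$1 - k) * n$2 * n$3)
      - (m$1 * m'$3 + m$3 * m'$1) * ((d$2 - k) * n$1 * n$3)
      - (m$1 * m'$2 + m$2 * m'$1) * ((d$3 - k) * n$1 * n$2)"
      by (simp add: algebra_simps power2_eq_square)
    also have "\<dots> = 0" using R by (elim conjE) (simp only: mult_zero_right add_0_left diff_zero)
    finally show "(\<chi> i. d$i * w$i) \<bullet> w' = k * (w \<bullet> w')" by simp
  qed
qed

text \<open>
  The surface of the theorem: a deformed spheroid, prolate along the third axis for \<open>a > b\<close> and oblate
  for \<open>a < b\<close>.
\<close>

locale quartic_spheroid =
  fixes a b \<epsilon> :: real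
  assumes a_pos: "a > 0" and b_pos: "b > 0" and eps_pos: "\<epsilon> > 0"
begin

abbreviation "A \<equiv> vector [a, a, b] :: real^3"
abbreviation "E \<equiv> vector [\<epsilon>, \<epsilon>, 0] :: real^3"
abbreviation "S \<equiv> quartic_surface A E"

lemma A_pos: "A $ i > 0" and E_nonneg: "E $ i \<ge> 0"
  using exhaust_3[of i] a_pos b_pos eps_pos by auto

sublocale level_surface "quartic A E" "quartic_grad A E" "quartic_hess A E" 1 S
  by (rule quartic_level_surface[OF A_pos E_nonneg])

lemma surface_iff:
  "p \<in> S \<longleftrightarrow> a * (p$1)^2 + \<epsilon> * (p$1)^4 + a * (p$2)^2 + \<epsilon> * (p$2)^4 + b * (p$3)^2 = 1"
  by (simp add: quartic_surface_def quartic_def sum_3 algebra_simps)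

lemma grad_components:
  "quartic_grad A E p $ 1 = 2 * p$1 * (a + 2 * \<epsilon> * (p$1)^2)"
  "quartic_grad A E p $ 2 = 2 * p$2 * (a + 2 * \<epsilon> * (p$2)^2)"
  "quartic_grad A E p $ 3 = 2 * p$3 * b"
  by (simp_all add: quartic_grad_def)

lemma factor_pos: "a + 2 * \<epsilon> * t^2 > 0"
  using a_pos eps_pos by (simp add: add_pos_nonneg)

text \<open>
  The umbilic equations sorted by vanishing coordinates: poles, the two meridians, the equator
  without its intersections with the meridians, and the points off the coordinate planes.
\<close>

definition umbilic_condition :: "real \<Rightarrow> real \<Rightarrow> real \<Rightarrow> bool" where
  "umbilic_condition x y z \<longleftrightarrow>
    x = 0 \<and> y = 0
    \<or> x = 0 \<and> y \<noteq> 0 \<and> z \<noteq> 0 \<and> (a - b) * (a + 2 * \<epsilon> * y^2)^2 = 6 * \<epsilon> * b^2 * z^2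
    \<or> y = 0 \<and> x \<noteq> 0 \<and> z \<noteq> 0 \<and> (a - b) * (a + 2 * \<epsilon> * x^2)^2 = 6 * \<epsilon> * b^2 * z^2
    \<or> z = 0 \<and> x \<noteq> 0 \<and> y \<noteq> 0 \<and>
      (6 * \<epsilon> * x^2 - (b - a)) * (y^2 * (a + 2 * \<epsilon> * y^2)^2)
      + (6 * \<epsilon> * y^2 - (b - a)) * (x^2 * (a + 2 * \<epsilon> * x^2)^2) = 0
    \<or> x \<noteq> 0 \<and> y \<noteq> 0 \<and> z \<noteq> 0 \<and> 6 * \<epsilon> * x^2 = b - a \<and> 6 * \<epsilon> * y^2 = b - a"

text \<open>
  The vanishing coordinates decide which of the six equations are nontrivial. If exactly one
  coordinate vanishes, they force \<open>k\<close> to be the Hessian entry of that coordinate and leave one condition;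
  if none vanishes, all three entries equal \<open>k\<close>. At the intersections of the equator with the
  meridians, \<open>k\<close> would have to be both \<open>2 a\<close> and \<open>2 b\<close>.
\<close>

lemma hess_umbilic_iff_condition:
  assumes "a \<noteq> b" "p \<in> S"
  shows "hess_umbilic p \<longleftrightarrow> umbilic_condition (p$1) (p$2) (p$3)"
proof -
  define x y z where "x = p$1" and "y = p$2" and "z = p$3"
  define u v where "u = a + 2 * \<epsilon> * x^2" and "v = a + 2 * \<epsilon> * y^2"
  have uv: "u > 0" "v > 0" using factor_pos by (simp_all add: u_def v_def)
  let ?P = "\<lambda>k. (2 * a + 12 * \<epsilon> * x^2 - k) * (2 * y * v) * (2 * z * b) = 0
    \<and> (2 * a + 12 * \<epsilon> * y^2 - k) * (2 * x * u) * (2 * z * b) = 0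
    \<and> (2 * b - k) * (2 * x * u) * (2 * y * v) = 0
    \<and> (2 * a + 12 * \<epsilon> * y^2 - k) * (2 * z * b)^2 + (2 * b - k) * (2 * y * v)^2 = 0
    \<and> (2 * a + 12 * \<epsilon> * x^2 - k) * (2 * z * b)^2 + (2 * b - k) * (2 * x * u)^2 = 0
    \<and> (2 * a + 12 * \<epsilon> * x^2 - k) * (2 * y * v)^2 + (2 * a + 12 * \<epsilon> * y^2 - k) * (2 * x * u)^2 = 0"
  have hess: "quartic_hess A E p = (\<lambda>w. \<chi> i. (\<chi> i. 2 * A$i + 12 * E$i * (p$i)^2) $ i * w$i)"
    by (simp add: quartic_hess_def fun_eq_iff)
  have "hess_umbilic p \<longleftrightarrow> (\<exists>k. ?P k)"
    unfolding hess_umbilic_def hess diagonal_scalar_on_plane_iff[OF grad_nonzero[OF assms(2)]]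
    by (simp add: grad_components x_def y_def z_def u_def v_def)
  also have "\<dots> \<longleftrightarrow> umbilic_condition x y z"
  proof -
    consider "x = 0" "y = 0" | "x = 0" "y \<noteq> 0" "z = 0" | "x = 0" "y \<noteq> 0" "z \<noteq> 0"
      | "x \<noteq> 0" "y = 0" "z = 0" | "x \<noteq> 0" "y = 0" "z \<noteq> 0"
      | "x \<noteq> 0" "y \<noteq> 0" "z = 0" | "x \<noteq> 0" "y \<noteq> 0" "z \<noteq> 0" by blast
    then show ?thesis
    proof cases
      case 1
      then have "?P (2 * a)" by simp
      then show ?thesis using 1 by (auto simp: umbilic_condition_def)
    next
      case 2
      have "\<not> ?P k" for k using 2 uv assms(1) by auto
      then show ?thesis using 2 by (simp add: umbilic_condition_def)
    next
      case 3
      have "(\<exists>k. ?P k) \<longleftrightarrow> ?P (2 * a)"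
        using 3 uv b_pos by auto
      also have "\<dots> \<longleftrightarrow> (a - b) * v^2 = 6 * \<epsilon> * b^2 * z^2"
      proof -
        have "(12 * \<epsilon> * y^2) * (2 * z * b)^2 + (2 * b - 2 * a) * (2 * y * v)^2
          = 8 * y^2 * (6 * \<epsilon> * b^2 * z^2 - (a - b) * v^2)"
          by (simp add: power2_eq_square algebra_simps)
        then show ?thesis using 3 by auto
      qed
      finally show ?thesis using 3 by (simp add: umbilic_condition_def v_def)
    next
      case 4
      have "\<not> ?P k" for k using 4 uv assms(1) by auto
      then show ?thesis using 4 by (simp add: umbilic_condition_def)
    next
      case 5
      have "(\<exists>k. ?P k) \<longleftrightarrow> ?P (2 * a)"
        using 5 uv b_pos by auto
      also have "\<dots> \<longleftrightarrow> (a - b) * u^2 = 6 * \<epsilon> * b^2 * z^2"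
      proof -
        have "(12 * \<epsilon> * x^2) * (2 * z * b)^2 + (2 * b - 2 * a) * (2 * x * u)^2
          = 8 * x^2 * (6 * \<epsilon> * b^2 * z^2 - (a - b) * u^2)"
          by (simp add: power2_eq_square algebra_simps)
        then show ?thesis using 5 by auto
      qed
      finally show ?thesis using 5 by (simp add: umbilic_condition_def u_def)
    next
      case 6
      have "(\<exists>k. ?P k) \<longleftrightarrow> ?P (2 * b)"
        using 6 uv b_pos by auto
      also have "\<dots> \<longleftrightarrow> (6 * \<epsilon> * x^2 - (b - a)) * (y^2 * v^2) + (6 * \<epsilon> * y^2 - (b - a)) * (x^2 * u^2) = 0"
      proof -
        have "(2 * a + 12 * \<epsilon> * x^2 - 2 * b) * (2 * y * v)^2 + (2 * a + 12 * \<epsilon> * y^2 - 2 * b) * (2 * x * u)^2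
          = 8 * ((6 * \<epsilon> * x^2 - (b - a)) * (y^2 * v^2) + (6 * \<epsilon> * y^2 - (b - a)) * (x^2 * u^2))"
          by (simp add: power2_eq_square algebra_simps)
        then show ?thesis using 6 by auto
      qed
      finally show ?thesis using 6 by (simp add: umbilic_condition_def u_def v_def)
    next
      case 7
      have "(\<exists>k. ?P k) \<longleftrightarrow> 2 * a + 12 * \<epsilon> * x^2 = 2 * b \<and> 2 * a + 12 * \<epsilon> * y^2 = 2 * b"
      proof
        assume "\<exists>k. ?P k"
        then show "2 * a + 12 * \<epsilon> * x^2 = 2 * b \<and> 2 * a + 12 * \<epsilon> * y^2 = 2 * b"
          using 7 uv b_pos by auto
      next
        assume "2 * a + 12 * \<epsilon> * x^2 = 2 * b \<and> 2 * a + 12 * \<epsilon> * y^2 = 2 * b"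
        then have "?P (2 * b)" by simp
        then show "\<exists>k. ?P k" by blast
      qed
      also have "\<dots> \<longleftrightarrow> 6 * \<epsilon> * x^2 = b - a \<and> 6 * \<epsilon> * y^2 = b - a" by auto
      finally show ?thesis using 7 by (simp add: umbilic_condition_def)
    qed
  qed
  finally show ?thesis by (simp add: x_def y_def z_def)
qed

lemma umbilic_points_iff:
  assumes "a \<noteq> b"
  shows "vector [x, y, z] \<in> umbilic_points S \<longleftrightarrow>
    a * x^2 + \<epsilon> * x^4 + a * y^2 + \<epsilon> * y^4 + b * z^2 = 1 \<and> umbilic_condition x y z"
proof -
  have "umbilic_points S = {p \<in> S. hess_umbilic p}"
    by (rule umbilic_points_eq[OF quartic_chart_exists[OF A_pos E_nonneg]])
  then show ?thesis
    using hess_umbilic_iff_condition[OF assms, of "vector [x, y, z]"] by (auto simp: surface_iff)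
qed

section \<open>The index of the poles\<close>

text \<open>
  The mixed coefficient of the principal direction equation in the coordinates \<open>x\<close>, \<open>y\<close> vanishes for
  \<open>x\<^sup>2 = y\<^sup>2\<close> by symmetry; this is a quarter of its quotient by \<open>x\<^sup>2 - y\<^sup>2\<close>. Its value at the poles is
  twice \<open>6 \<epsilon> b - a\<^sup>2 (a - b)\<close>, so it changes sign at the threshold of the case \<open>a > b\<close>.
\<close>

definition twist :: "real \<Rightarrow> real \<Rightarrow> real \<Rightarrow> real" where
  "twist s t z = -2 * (a - b) * (a^2 + 4 * a * \<epsilon> * (s + t) + 4 * \<epsilon>^2 * (s^2 + s * t + t^2))
     - 48 * \<epsilon>^2 * (s * t) * (a + \<epsilon> * (s + t)) + 12 * \<epsilon> * b^2 * z^2"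

lemma twist_identity:
  "(2 * y * (a + 2 * \<epsilon> * y^2))^2 * (2 * a + 12 * \<epsilon> * x^2 - 2 * b)
   - (2 * x * (a + 2 * \<epsilon> * x^2))^2 * (2 * a + 12 * \<epsilon> * y^2 - 2 * b)
   + (2 * z * b)^2 * ((2 * a + 12 * \<epsilon> * x^2) - (2 * a + 12 * \<epsilon> * y^2))
   = 4 * twist (x^2) (y^2) z * (x^2 - y^2)"
  unfolding twist_def by algebra

text \<open>
  Eliminating \<open>w3\<close> turns the triple product of the normal \<open>(P, Q, R)\<close>, a tangent vector \<open>w\<close> and its image
  under the diagonal Hessian into a binary quadratic form in \<open>w1\<close>, \<open>w2\<close>, whose zeros are the
  principal directions.
\<close>

lemma principal_form:
  fixes P Q R c1 c2 c3 w1 w2 w3 :: real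
  assumes "P * w1 + Q * w2 + R * w3 = 0"
  shows "R * (c1 * w1 * (Q * w3 - w2 * R) + c2 * w2 * (R * w1 - w3 * P) + c3 * w3 * (P * w2 - w1 * Q))
    = - (P * Q * (c1 - c3) * w1^2 + (Q^2 * (c1 - c3) - P^2 * (c2 - c3) + R^2 * (c1 - c2)) * w1 * w2
        - P * Q * (c2 - c3) * w2^2)"
  using assms by algebra

text \<open>
  The field of \<open>umbilic_index_one\<close> has horizontal part proportional to \<open>(m1 (x - y), m2 (x + y))\<close>, the radial
  field turned by 45 degrees and weighted, and a third component that makes it tangent; the
  factor \<open>(2 z b)\<^sup>2\<close> only clears denominators. The weights \<open>m1\<close>, \<open>m2\<close> are chosen such that inserting it
  into the principal form turns the two pure squares into one multiple of \<open>x y P Q\<close>, while the mixed term becomes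
  a multiple of \<open>twist (x\<^sup>2 - y\<^sup>2)\<^sup>2\<close>. Both have the same sign, so their sum vanishes only at the
  pole.
\<close>

lemma pole_index:
  assumes p: "p \<in> S" "p$1 = 0" "p$2 = 0"
    and iso: "p isolated_in umbilic_points S"
    and \<delta>: "\<delta> = 1 \<or> \<delta> = (-1::real)" "\<delta> * (a - b) > 0"
    and V: "open V" "p \<in> V"
    and sign: "\<And>q. q \<in> S \<inter> V - {p} \<Longrightarrow> \<delta> * (2 * a + 12 * \<epsilon> * (q$1)^2 - 2 * b) > 0 \<and>
      \<delta> * (2 * a + 12 * \<epsilon> * (q$2)^2 - 2 * b) > 0 \<and> \<delta> * twist ((q$1)^2) ((q$2)^2) (q$3) < 0 \<and> q$3 * p$3 > 0"
  shows "has_umbilic_index S p 1"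
proof -
  define m1 where "m1 q = sqrt (\<delta> * (2 * a + 12 * \<epsilon> * (q$2)^2 - 2 * b))" for q :: "real^3"
  define m2 where "m2 q = sqrt (\<delta> * (2 * a + 12 * \<epsilon> * (q$1)^2 - 2 * b))" for q :: "real^3"
  define Z :: "real^3 \<Rightarrow> real^3" where
    "Z q = (\<chi> i. if i = 1 then (2 * q$3 * b)^2 * m1 q * (q$1 - q$2)
      else if i = 2 then (2 * q$3 * b)^2 * m2 q * (q$1 + q$2)
      else - (2 * q$3 * b) * (2 * q$1 * (a + 2 * \<epsilon> * (q$1)^2) * m1 q * (q$1 - q$2)
        + 2 * q$2 * (a + 2 * \<epsilon> * (q$2)^2) * m2 q * (q$1 + q$2)))" for q
  define \<mu> where "\<mu> = sqrt (\<delta> * (2 * a - 2 * b))"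
  have \<delta>2: "\<delta> * (2 * a - 2 * b) > 0" using \<delta>(2) by (simp add: algebra_simps)
  then have \<mu>: "\<mu> > 0" by (simp add: \<mu>_def)
  have p3: "p$3 \<noteq> 0" using p by (auto simp: surface_iff)
  define K :: "real^3 \<Rightarrow> real^3" where
    "K h = (\<chi> i. if i = 1 then (2 * p$3 * b)^2 * \<mu> * (h$1 - h$2)
      else if i = 2 then (2 * p$3 * b)^2 * \<mu> * (h$1 + h$2) else 0)" for h
  have Z_comp: "Z q $ 1 = (2 * q$3 * b)^2 * m1 q * (q$1 - q$2)"
    "Z q $ 2 = (2 * q$3 * b)^2 * m2 q * (q$1 + q$2)"
    "Z q $ 3 = - (2 * q$3 * b) * (2 * q$1 * (a + 2 * \<epsilon> * (q$1)^2) * m1 q * (q$1 - q$2)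
        + 2 * q$2 * (a + 2 * \<epsilon> * (q$2)^2) * m2 q * (q$1 + q$2))" for q
    by (simp_all add: Z_def)
  have m_deriv: "\<exists>m1'. (m1 has_derivative m1') (at p)" "\<exists>m2'. (m2 has_derivative m2') (at p)"
    unfolding m1_def m2_def using \<delta>2 p
    by (auto intro!: exI derivative_eq_intros has_derivative_vec_component)
  show ?thesis
  proof (rule umbilic_index_one[OF iso V, of Z K])
    show "continuous_on V Z"
      unfolding Z_def m1_def m2_def
    proof (rule continuous_on_vec_lambda)
      fix i :: 3
      show "continuous_on V (\<lambda>q. if i = 1 then (2 * q$3 * b)^2 * sqrt (\<delta> * (2 * a + 12 * \<epsilon> * (q$2)^2 - 2 * b)) * (q$1 - q$2)
        else if i = 2 then (2 * q$3 * b)^2 * sqrt (\<delta> * (2 * a + 12 * \<epsilon> * (q$1)^2 - 2 * b)) * (q$1 + q$2)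
        else - (2 * q$3 * b) * (2 * q$1 * (a + 2 * \<epsilon> * (q$1)^2) * sqrt (\<delta> * (2 * a + 12 * \<epsilon> * (q$2)^2 - 2 * b)) * (q$1 - q$2)
          + 2 * q$2 * (a + 2 * \<epsilon> * (q$2)^2) * sqrt (\<delta> * (2 * a + 12 * \<epsilon> * (q$1)^2 - 2 * b)) * (q$1 + q$2)))"
        by (cases "i = 1"; cases "i = 2"; simp; intro continuous_intros)
    qed
    show "(Z has_derivative K) (at p)"
    proof (rule has_derivative_vecI)
      fix i :: 3
      obtain m1' m2' where m': "(m1 has_derivative m1') (at p)" "(m2 has_derivative m2') (at p)"
        using m_deriv by blast
      have mp: "m1 p = \<mu>" "m2 p = \<mu>" using p by (simp_all add: m1_def m2_def \<mu>_def algebra_simps)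
      have "((\<lambda>q. Z q $ 1) has_derivative (\<lambda>h. K h $ 1)) (at p)"
        "((\<lambda>q. Z q $ 2) has_derivative (\<lambda>h. K h $ 2)) (at p)"
        "((\<lambda>q. Z q $ 3) has_derivative (\<lambda>h. K h $ 3)) (at p)"
        unfolding Z_comp K_def
        by (auto intro!: derivative_eq_intros m' has_derivative_vec_component simp: mp p)
      then show "((\<lambda>q. Z q $ i) has_derivative (\<lambda>h. K h $ i)) (at p)"
        using exhaust_3[of i] by auto
    qed
    show "Z p = 0" by (simp add: vec_eq_iff Z_def p)
  next
    fix w assume w: "quartic_grad A E p \<bullet> w = 0" "w \<noteq> 0"
    then have "w$3 = 0" using p p3 b_pos by (simp add: inner_vec_def sum_3 grad_components)
    moreover from this have "w$1 \<noteq> 0 \<or> w$2 \<noteq> 0" using w(2) by (auto simp: vec_eq_iff forall_3)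
    moreover have "K w \<bullet> w = (2 * p$3 * b)^2 * \<mu> * ((w$1)^2 + (w$2)^2)"
      by (simp add: K_def inner_vec_def sum_3 algebra_simps power2_eq_square)
    ultimately show "K w \<bullet> w > 0"
      using \<mu> p3 b_pos by (simp add: sum_power2_gt_zero_iff)
  next
    fix q assume "q \<in> S \<inter> V - {p}"
    show "quartic_grad A E q \<bullet> Z q = 0"
      by (simp add: inner_vec_def sum_3 grad_components Z_comp power2_eq_square algebra_simps)
  next
    fix q assume q: "q \<in> S \<inter> V - {p}"
    define x y z where "x = q$1" and "y = q$2" and "z = q$3"
    define u v where "u = a + 2 * \<epsilon> * x^2" and "v = a + 2 * \<epsilon> * y^2"
    define P Q R where "P = 2 * x * u" and "Q = 2 * y * v" and "R = 2 * z * b"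
    define c1 c2 c3 where "c1 = 2 * a + 12 * \<epsilon> * x^2" and "c2 = 2 * a + 12 * \<epsilon> * y^2" and "c3 = 2 * b"
    define \<beta> where "\<beta> = Q^2 * (c1 - c3) - P^2 * (c2 - c3) + R^2 * (c1 - c2)"
    define \<Phi> where "\<Phi> = P * Q * (c1 - c3) * (m1 q * (x - y))^2
        + \<beta> * (m1 q * (x - y)) * (m2 q * (x + y)) - P * Q * (c2 - c3) * (m2 q * (x + y))^2"
    have sg: "\<delta> * (c1 - c3) > 0" "\<delta> * (c2 - c3) > 0" "\<delta> * twist (x^2) (y^2) z < 0" "z * p$3 > 0"
      using sign[OF q] by (simp_all add: c1_def c2_def c3_def x_def y_def z_def)
    have m1: "m1 q > 0" "(m1 q)^2 = \<delta> * (c2 - c3)" and m2: "m2 q > 0" "(m2 q)^2 = \<delta> * (c1 - c3)"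
      using sg by (simp_all add: m1_def m2_def c1_def c2_def c3_def x_def y_def)
    have \<beta>: "\<beta> = 4 * twist (x^2) (y^2) z * (x^2 - y^2)"
      unfolding twist_identity[symmetric] \<beta>_def P_def Q_def R_def u_def v_def c1_def c2_def c3_def ..
    have uv: "u > 0" "v > 0" using factor_pos by (simp_all add: u_def v_def)
    have \<delta>\<delta>: "\<delta> * \<delta> = 1" using \<delta>(1) by auto
    have "x \<noteq> 0 \<or> y \<noteq> 0"
    proof (rule ccontr)
      assume "\<not> (x \<noteq> 0 \<or> y \<noteq> 0)"
      then have xy: "x = 0" "y = 0" by auto
      then have "b * z^2 = b * (p$3)^2"
        using q p by (auto simp: surface_iff x_def y_def z_def)
      then have "z = p$3 \<or> z = - p$3" using b_pos by (simp add: power2_eq_iff)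
      then have "z = p$3" using sg(4) by (auto simp: mult_less_0_iff zero_less_mult_iff)
      then have "q = p" using xy p by (simp add: vec_eq_iff forall_3 x_def y_def z_def)
      with q show False by simp
    qed
    define G where "G = (u * v) * ((\<delta> * (c1 - c3)) * (\<delta> * (c2 - c3)))"
    define T where "T = (\<delta> * twist (x^2) (y^2) z) * (m1 q * m2 q)"
    have G: "G > 0" using uv sg by (simp add: G_def)
    have T: "T < 0" using sg(3) m1(1) m2(1) by (simp add: T_def mult_neg_pos)
    \<comment> \<open>\<open>\<Phi>\<close> is the principal form at \<open>Z\<close>, up to the factor \<open>R\<^sup>4\<close>; multiplied by \<open>\<delta>\<close> it is a sum of two nonpositive terms.\<close>
    have "\<delta> * \<Phi> = P * Q * ((\<delta> * (c1 - c3)) * (m1 q)^2 * (x - y)^2 - (\<delta> * (c2 - c3)) * (m2 q)^2 * (x + y)^2)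
        + \<delta> * \<beta> * (x^2 - y^2) * (m1 q * m2 q)"
      by (simp add: \<Phi>_def algebra_simps power2_eq_square)
    also have "\<dots> = - 16 * ((x^2 * y^2) * G) + 4 * (T * (x^2 - y^2)^2)"
      unfolding m1 m2 \<beta> P_def Q_def G_def T_def by (simp add: algebra_simps power2_eq_square)
    also have "\<dots> < 0"
    proof (cases "x^2 = y^2")
      case True
      then have "x^2 * y^2 > 0" using \<open>x \<noteq> 0 \<or> y \<noteq> 0\<close> by auto
      then have "(x^2 * y^2) * G > 0" using G by (rule mult_pos_pos)
      then show ?thesis using True by simp
    next
      case False
      then have "T * (x^2 - y^2)^2 < 0" by (intro mult_neg_pos[OF T]) simp
      moreover have "(x^2 * y^2) * G \<ge> 0"
        by (rule mult_nonneg_nonneg[OF _ less_imp_le[OF G]]) simp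
      ultimately show ?thesis by linarith
    qed
    finally have "\<Phi> \<noteq> 0" by auto
    have R: "R \<noteq> 0" using sg(4) b_pos by (auto simp: R_def)
    define Z1 Z2 Z3 where "Z1 = R^2 * m1 q * (x - y)" and "Z2 = R^2 * m2 q * (x + y)"
      and "Z3 = - R * (P * m1 q * (x - y) + Q * m2 q * (x + y))"
    have Zq: "Z q $ 1 = Z1" "Z q $ 2 = Z2" "Z q $ 3 = Z3"
      by (simp_all add: Z_comp Z1_def Z2_def Z3_def R_def P_def Q_def u_def v_def x_def y_def z_def)
    have "R * (quartic_hess A E q (Z q) \<bullet> cross3 (quartic_grad A E q) (Z q)) =
        R * (c1 * Z1 * (Q * Z3 - Z2 * R) + c2 * Z2 * (R * Z1 - Z3 * P) + c3 * Z3 * (P * Z2 - Z1 * Q))"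
      by (simp add: inner_vec_def sum_3 cross_components quartic_hess_def grad_components Zq
          P_def Q_def R_def u_def v_def c1_def c2_def c3_def x_def y_def z_def)
    also have "\<dots> = - (P * Q * (c1 - c3) * Z1^2 + \<beta> * Z1 * Z2 - P * Q * (c2 - c3) * Z2^2)"
      unfolding \<beta>_def
      by (rule principal_form) (simp add: Z1_def Z2_def Z3_def algebra_simps power2_eq_square)
    also have "\<dots> = - (R^4 * \<Phi>)"
      by (simp add: \<Phi>_def Z1_def Z2_def algebra_simps power2_eq_square power4_eq_xxxx)
    also have "\<dots> \<noteq> 0" using R \<open>\<Phi> \<noteq> 0\<close> by simp
    finally show "quartic_hess A E q (Z q) \<bullet> cross3 (quartic_grad A E q) (Z q) \<noteq> 0" by auto
  qed
qed

text \<open>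
  At the pole \<open>twist\<close> is at most zero by the threshold. Away from it \<open>b z\<^sup>2 < 1\<close>, so the term in \<open>z\<close> is
  strictly smaller than at the pole, and the other terms are at most what they are there. Hence equality
  in the threshold is admissible.
\<close>

lemma pole_index_prolate:
  assumes "a > b" "\<epsilon> \<le> a^2 / 6 * (a / b - 1)"
    and p: "p \<in> S" "p$1 = 0" "p$2 = 0" and iso: "p isolated_in umbilic_points S"
  shows "has_umbilic_index S p 1"
proof (rule pole_index[OF p iso, of 1 "{q. q$3 * p$3 > 0}"])
  show "open {q. q$3 * p$3 > 0}" by (intro open_Collect_less continuous_intros)
  have "p$3 \<noteq> 0" using p by (auto simp: surface_iff)
  then show "p \<in> {q. q$3 * p$3 > 0}" by (simp add: zero_less_mult_iff) linarith
  fix q assume q: "q \<in> S \<inter> {q. q$3 * p$3 > 0} - {p}"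
  define s t where "s = (q$1)^2" and "t = (q$2)^2"
  have st: "s \<ge> 0" "t \<ge> 0" by (simp_all add: s_def t_def)
  have surf: "b * (q$3)^2 = 1 - a * (s + t) - \<epsilon> * (s^2 + t^2)"
    using q by (simp add: surface_iff s_def t_def algebra_simps)
  have "s + t > 0"
  proof (rule ccontr)
    assume "\<not> s + t > 0"
    then have "q$1 = 0" "q$2 = 0" using st by (simp_all add: s_def t_def sum_power2_gt_zero_iff)
    moreover from this have "b * (q$3)^2 = b * (p$3)^2"
      using q p by (simp add: surface_iff)
    then have "q$3 = p$3 \<or> q$3 = - p$3" using b_pos by (simp add: power2_eq_iff)
    then have "q$3 = p$3" using q by (auto simp: zero_less_mult_iff)
    ultimately have "q = p" using p by (simp add: vec_eq_iff forall_3)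
    with q show False by simp
  qed
  have thr: "6 * \<epsilon> * b \<le> (a - b) * a^2"
    using assms(2) b_pos by (simp add: field_simps power2_eq_square)
  have "\<epsilon> * (b * (b * (q$3)^2)) < \<epsilon> * (b * 1)"
  proof (intro mult_strict_left_mono)
    have "a * (s + t) > 0" "\<epsilon> * (s^2 + t^2) \<ge> 0"
      using \<open>s + t > 0\<close> a_pos eps_pos by simp_all
    then show "b * (q$3)^2 < 1" using surf by linarith
  qed (use b_pos eps_pos in auto)
  moreover define G where "G = a^2 + 4 * a * \<epsilon> * (s + t) + 4 * \<epsilon>^2 * (s^2 + s * t + t^2)"
  have "(a - b) * a^2 \<le> (a - b) * G"
    using assms(1) st a_pos eps_pos unfolding G_def by (intro mult_left_mono) simp_all
  moreover define H where "H = 48 * \<epsilon>^2 * (s * t) * (a + \<epsilon> * (s + t))"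
  have "H \<ge> 0"
    using st a_pos eps_pos by (simp add: H_def)
  moreover have "twist s t (q$3) = -2 * ((a - b) * G) - H + 12 * (\<epsilon> * (b * (b * (q$3)^2)))"
    unfolding twist_def G_def H_def by algebra
  ultimately have "twist s t (q$3) < 0"
    using thr by linarith
  moreover have "12 * \<epsilon> * s \<ge> 0" "12 * \<epsilon> * t \<ge> 0" using st eps_pos by simp_all
  ultimately show "1 * (2 * a + 12 * \<epsilon> * (q$1)^2 - 2 * b) > 0 \<and>
      1 * (2 * a + 12 * \<epsilon> * (q$2)^2 - 2 * b) > 0 \<and> 1 * twist ((q$1)^2) ((q$2)^2) (q$3) < 0 \<and> q$3 * p$3 > 0"
    using assms(1) q by (simp flip: s_def t_def)
qed (use assms(1) in auto)

text \<open>
  For \<open>a < b\<close> the required signs hold strictly at the pole for every \<open>\<epsilon>\<close>, hence nearby.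
\<close>

lemma pole_index_oblate:
  assumes "a < b"
    and p: "p \<in> S" "p$1 = 0" "p$2 = 0" and iso: "p isolated_in umbilic_points S"
  shows "has_umbilic_index S p 1"
proof (rule pole_index[OF p iso, of "-1" "{q. q$3 * p$3 > 0} \<inter> {q. 2 * a + 12 * \<epsilon> * (q$1)^2 < 2 * b}
    \<inter> {q. 2 * a + 12 * \<epsilon> * (q$2)^2 < 2 * b} \<inter> {q. twist ((q$1)^2) ((q$2)^2) (q$3) > 0}"])
  show "open ({q. q$3 * p$3 > 0} \<inter> {q. 2 * a + 12 * \<epsilon> * (q$1)^2 < 2 * b}
    \<inter> {q. 2 * a + 12 * \<epsilon> * (q$2)^2 < 2 * b} \<inter> {q. twist ((q$1)^2) ((q$2)^2) (q$3) > 0})"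
    unfolding twist_def by (intro open_Int open_Collect_less continuous_intros)
  have "p$3 \<noteq> 0" using p by (auto simp: surface_iff)
  then have "p$3 * p$3 > 0" by (simp add: zero_less_mult_iff) linarith
  moreover have "twist ((p$1)^2) ((p$2)^2) (p$3) > 0"
  proof -
    have "(b - a) * a^2 \<ge> 0" "\<epsilon> * b^2 * (p$3)^2 > 0"
      using assms(1) eps_pos b_pos \<open>p$3 \<noteq> 0\<close> by simp_all
    then show ?thesis by (simp add: twist_def p algebra_simps)
  qed
  ultimately show "p \<in> {q. q$3 * p$3 > 0} \<inter> {q. 2 * a + 12 * \<epsilon> * (q$1)^2 < 2 * b}
    \<inter> {q. 2 * a + 12 * \<epsilon> * (q$2)^2 < 2 * b} \<inter> {q. twist ((q$1)^2) ((q$2)^2) (q$3) > 0}"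
    using assms(1) p by simp
qed (use assms(1) in auto)

end

section \<open>Umbilics on the equator\<close>

text \<open>
  Up to a factor \<open>2 \<epsilon>\<close>, the umbilic equation on the equator in the variables
  \<open>u = a + 2 \<epsilon> x\<^sup>2\<close>, \<open>v = a + 2 \<epsilon> y\<^sup>2\<close>, with \<open>e = 2 a + b\<close>.
\<close>

definition equator_form :: "real \<Rightarrow> real \<Rightarrow> real \<Rightarrow> real \<Rightarrow> real" where
  "equator_form a e u v = (3 * u - e) * (v - a) * v^2 + (3 * v - e) * (u - a) * u^2"

text \<open>
  Its restriction to the circle \<open>u\<^sup>2 + v\<^sup>2 = 2 m\<close>, on which every symmetric polynomial in \<open>u\<close> and \<open>v\<close> is a
  polynomial in \<open>s = u + v\<close>.
\<close>

definition equator_cubic :: "real \<Rightarrow> real \<Rightarrow> real \<Rightarrow> real \<Rightarrow> real" where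
  "equator_cubic a e m s =
    (e - 3 * a) / 2 * s^3 + 3 * m * s^2 - 3 * m * (e - a) * s + 2 * e * a * m - 6 * m^2"

lemma equator_form_symmetric:
  assumes "u^2 + v^2 = 2 * m"
  shows "equator_form a e u v = equator_cubic a e m (u + v)"
proof -
  have m: "m = (u^2 + v^2) / 2" using assms by simp
  show ?thesis
    unfolding equator_form_def equator_cubic_def m
    by (simp add: field_simps power2_eq_square power3_eq_cube)
qed

text \<open>
  In the difference quotient, \<open>s\<^sup>2 \<ge> 2 m\<close> makes the contribution of the cubic term at least
  \<open>3 m (e - 3 a)\<close>, which leaves \<open>3 m (s + t - 2 a) > 0\<close>.
\<close>

lemma equator_cubic_strict_mono:
  assumes "a > 0" "e > 3 * a" "m > 0" "s^2 \<ge> 2 * m" "s > a" "s < t"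
  shows "equator_cubic a e m s < equator_cubic a e m t"
proof -
  have "s > 0" using assms by linarith
  have st: "s * s \<le> s * t" "s * t \<le> t * t"
    using assms \<open>s > 0\<close> by (intro mult_left_mono mult_right_mono; linarith)+
  have sum: "s^2 + s * t + t^2 \<ge> 6 * m"
    using st assms(4) by (simp add: power2_eq_square)
  have "(e - 3 * a) / 2 * (s^2 + s * t + t^2) \<ge> (e - 3 * a) / 2 * (6 * m)"
    using sum assms(2) by (intro mult_left_mono) auto
  moreover have "3 * m * (s + t - 2 * a) > 0" using assms by simp
  moreover have "(e - 3 * a) / 2 * (6 * m) + 3 * m * (s + t) - 3 * m * (e - a) = 3 * m * (s + t - 2 * a)"
    by (simp add: field_simps)
  ultimately have pos: "(e - 3 * a) / 2 * (s^2 + s * t + t^2) + 3 * m * (s + t) - 3 * m * (e - a) > 0"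
    by linarith
  have "equator_cubic a e m t - equator_cubic a e m s =
      (t - s) * ((e - 3 * a) / 2 * (s^2 + s * t + t^2) + 3 * m * (s + t) - 3 * m * (e - a))"
    unfolding equator_cubic_def by (simp add: field_simps power2_eq_square power3_eq_cube)
  also have "\<dots> > 0" using pos assms(6) by (intro mult_pos_pos) auto
  finally show ?thesis by simp
qed

lemma equator_cubic_sum_mono:
  assumes "a > 0" "e > 3 * a" and uv: "u > a" "v > a" "u^2 + v^2 = 2 * m" and "u + v < t"
  shows "equator_cubic a e m (u + v) < equator_cubic a e m t"
proof (rule equator_cubic_strict_mono[OF assms(1,2)])
  have pos: "u > 0" "v > 0" using uv assms(1) by linarith+
  show "m > 0" using uv(3) pos by (smt (verit) zero_less_power)
  show "(u + v)^2 \<ge> 2 * m" using uv(3) pos by (simp add: power2_sum)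
  show "u + v > a" using uv pos by linarith
qed fact

text \<open>
  By monotonicity the sum \<open>u + v\<close> is determined, and together with the sum of squares it determines
  the unordered pair.
\<close>

lemma equator_solutions_unique:
  assumes "a > 0" "e > 3 * a"
    and uv: "u > a" "v > a" "u^2 + v^2 = 2 * m" "equator_form a e u v = 0"
    and uv': "u' > a" "v' > a" "u'^2 + v'^2 = 2 * m" "equator_form a e u' v' = 0"
  shows "u = u' \<and> v = v' \<or> u = v' \<and> v = u'"
proof -
  have eq: "equator_cubic a e m (u + v) = equator_cubic a e m (u' + v')"
    using uv(4) uv'(4) equator_form_symmetric[OF uv(3)] equator_form_symmetric[OF uv'(3)] by metis
  have sum: "u + v = u' + v'"
    using equator_cubic_sum_mono[OF assms(1,2) uv(1-3), of "u' + v'"]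
      equator_cubic_sum_mono[OF assms(1,2) uv'(1-3), of "u + v"] eq by linarith
  then have v: "v = u' + v' - u" by simp
  have "(u - u') * (u - v') = 0"
    using uv(3) uv'(3) unfolding v by algebra
  then show ?thesis using v by auto
qed

text \<open>
  On the circle \<open>u + v\<close> is at most \<open>2 r\<close> with \<open>r = sqrt m\<close>, up to which the cubic
  increases; there it is still negative if \<open>3 r < e\<close>.
\<close>

lemma equator_no_solution:
  assumes "a > 0" "e > 3 * a" "u > a" "v > a" "u^2 + v^2 = 2 * m" "9 * m < e^2"
  shows "equator_form a e u v \<noteq> 0"
proof
  assume zero: "equator_form a e u v = 0"
  define r where "r = sqrt m"
  have pos: "u > 0" "v > 0" using assms by linarith+
  have "a^2 < u^2" "a^2 < v^2" using assms by (simp_all add: power_strict_mono)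
  then have m: "a^2 < m" using assms(5) by linarith
  then have "m > 0" by (smt (verit) zero_le_power2)
  then have r: "r^2 = m" "r > 0" by (simp_all add: r_def)
  have "r > a" using m r assms(1) by (metis less_imp_le power2_less_imp_less)
  have "3 * r < e"
    by (rule power2_less_imp_less) (use assms r in \<open>simp_all add: power_mult_distrib\<close>)
  have neg: "equator_form a e r r < 0"
  proof -
    have "equator_form a e r r = 2 * ((3 * r - e) * ((r - a) * r^2))"
      by (simp add: equator_form_def)
    moreover have "(r - a) * r^2 > 0" using \<open>r > a\<close> \<open>m > 0\<close> r by simp
    moreover from this have "(3 * r - e) * ((r - a) * r^2) < 0"
      using \<open>3 * r < e\<close> by (intro mult_neg_pos) auto
    ultimately show ?thesis by linarith
  qed
  have "equator_cubic a e m (r + r) < 0"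
    using neg equator_form_symmetric[of r r m a e] r(1) by simp
  moreover have "equator_cubic a e m (u + v) = 0"
    using zero equator_form_symmetric[OF assms(5)] by simp
  ultimately have "\<not> u + v < r + r" "u + v \<noteq> r + r"
    using equator_cubic_sum_mono[OF assms(1-5), of "r + r"] by auto
  then have "(u + v)^2 > (r + r)^2" using r by (intro power_strict_mono) auto
  moreover have "(u + v)^2 \<le> 2 * (u^2 + v^2)"
    using zero_le_power2[of "u - v"] by (simp add: power2_eq_square algebra_simps)
  ultimately show False using assms(5) r(1) by (simp add: power2_eq_square)
qed

text \<open>
  Intermediate value theorem along the arc from \<open>v = a\<close>, where the form is negative, to \<open>u = v\<close>, where it
  is positive.
\<close>

lemma equator_solution_exists:
  assumes "a > 0" "e > 3 * a" "a^2 < m" "e^2 < 9 * m"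
  obtains u v where "v > a" "u > v" "u^2 + v^2 = 2 * m" "equator_form a e u v = 0"
proof -
  define r where "r = sqrt m"
  have "m > 0" using assms(3) by (smt (verit) zero_le_power2)
  then have r: "r^2 = m" "r > 0" by (simp_all add: r_def)
  have "r > a" using assms(1,3) r by (metis less_imp_le power2_less_imp_less)
  have "3 * r > e"
    by (rule power2_less_imp_less) (use assms r in \<open>simp_all add: power_mult_distrib\<close>)
  define w where "w v = sqrt (2 * m - v^2)" for v
  have w2: "(w v)^2 = 2 * m - v^2" "w v \<ge> r" if "a \<le> v" "v \<le> r" for v
  proof -
    have "v^2 \<le> m" using that assms(1) r by (metis order_trans less_imp_le power_mono)
    then show "(w v)^2 = 2 * m - v^2" using \<open>m > 0\<close> by (simp add: w_def)
    show "w v \<ge> r" unfolding w_def r_def using \<open>v^2 \<le> m\<close> by (intro real_sqrt_le_mono) simp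
  qed
  have wr: "w r = r" by (simp add: w_def r r_def[symmetric])
  have "continuous_on {a..r} (\<lambda>v. equator_form a e (w v) v)"
    unfolding equator_form_def w_def by (intro continuous_intros)
  moreover have left: "equator_form a e (w a) a < 0"
  proof -
    have "w a \<ge> r" using w2 \<open>r > a\<close> by simp
    then have "(w a - a) * (w a)^2 > 0" using \<open>r > a\<close> r by simp
    moreover have "equator_form a e (w a) a = (3 * a - e) * ((w a - a) * (w a)^2)"
      by (simp add: equator_form_def)
    ultimately show ?thesis using assms(2) by (simp add: mult_neg_pos)
  qed
  moreover have right: "equator_form a e (w r) r > 0"
    using \<open>3 * r > e\<close> \<open>r > a\<close> \<open>m > 0\<close> r by (simp add: wr equator_form_def)
  ultimately obtain v where v: "a \<le> v" "v \<le> r" "equator_form a e (w v) v = 0"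
    using IVT'[of "\<lambda>v. equator_form a e (w v) v" a 0 r] \<open>r > a\<close> by auto
  have "v \<noteq> a" "v \<noteq> r" using v(3) left right by auto
  then show thesis using that[of v "w v"] v w2[OF v(1,2)] by simp
qed

section \<open>Enumeration of the umbilic points\<close>

text \<open>
  Coordinate boxes describe all the point sets below as products of pairs \<open>{c, - c}\<close> and \<open>{0}\<close>, which
  makes cardinality and disjointness immediate.
\<close>

definition box3 :: "real set \<Rightarrow> real set \<Rightarrow> real set \<Rightarrow> (real^3) set" where
  "box3 A B C = {p. p$1 \<in> A \<and> p$2 \<in> B \<and> p$3 \<in> C}"

lemma vector_in_box3: "vector [x, y, z] \<in> box3 A B C \<longleftrightarrow> x \<in> A \<and> y \<in> B \<and> z \<in> C"
  by (simp add: box3_def)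

lemma box3_eq_image: "box3 A B C = (\<lambda>(x, y, z). vector [x, y, z]) ` (A \<times> B \<times> C)"
proof (intro equalityI subsetI)
  fix p assume p: "p \<in> box3 A B C"
  have "p = vector [p$1, p$2, p$3]" by (simp add: vec_eq_iff forall_3)
  with p show "p \<in> (\<lambda>(x, y, z). vector [x, y, z]) ` (A \<times> B \<times> C)"
    by (force simp: box3_def)
qed (auto simp: box3_def)

lemma card_box3: "card (box3 A B C) = card A * card B * card C"
proof -
  have "inj_on (\<lambda>(x, y, z). vector [x, y, z] :: real^3) (A \<times> B \<times> C)"
    by (auto simp: inj_on_def vec_eq_iff forall_3)
  then show ?thesis
    by (simp add: box3_eq_image card_image card_cartesian_product)
qed

lemma box3_disjoint:
  "A \<inter> A' = {} \<or> B \<inter> B' = {} \<or> C \<inter> C' = {} \<Longrightarrow> box3 A B C \<inter> box3 A' B' C' = {}"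
  unfolding box3_def by blast

lemma finite_box3: "finite A \<Longrightarrow> finite B \<Longrightarrow> finite C \<Longrightarrow> finite (box3 A B C)"
  by (simp add: box3_eq_image)

lemma set_eq_vectorI:
  fixes S T :: "(real^3) set"
  assumes "\<And>x y z. vector [x, y, z] \<in> S \<longleftrightarrow> vector [x, y, z] \<in> T"
  shows "S = T"
proof (rule set_eqI)
  fix p :: "real^3"
  have "p = vector [p$1, p$2, p$3]" by (simp add: vec_eq_iff forall_3)
  then show "p \<in> S \<longleftrightarrow> p \<in> T" using assms by metis
qed

lemma mem_pm_iff: "c \<ge> 0 \<Longrightarrow> x \<in> {c, -c} \<longleftrightarrow> x^2 = (c::real)^2"
  by (auto simp: power2_eq_iff)

lemma card_pm: "c > 0 \<Longrightarrow> card {c, - c :: real} = 2"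
  by (simp add: card_insert_if)

lemma finite_imp_isolated:
  fixes p :: "'a::t1_space"
  assumes "finite T" "p \<in> T" shows "p isolated_in T"
  using assms by (simp add: isolated_in_islimpt_iff islimpt_finite)

context quartic_spheroid
begin

abbreviation "poles \<equiv> box3 {0} {0} {sqrt (1 / b), - sqrt (1 / b)}"

lemma card_poles: "card poles = 2"
  using b_pos by (simp add: card_box3 card_pm)

lemma pole_iff: "z \<in> {sqrt (1 / b), - sqrt (1 / b)} \<longleftrightarrow> b * z^2 = 1"
  unfolding mem_pm_iff[OF real_sqrt_ge_zero[OF less_imp_le[OF divide_pos_pos[OF zero_less_one b_pos]]]]
  using b_pos by (simp add: field_simps)

lemma poles_on_surface: "p \<in> poles \<Longrightarrow> p \<in> S \<and> p$1 = 0 \<and> p$2 = 0"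
  using pole_iff[of "p$3"] by (simp add: box3_def surface_iff)

text \<open>
  On the meridian, \<open>4 \<epsilon> (a y\<^sup>2 + \<epsilon> y\<^sup>4) = (a + 2 \<epsilon> y\<^sup>2)\<^sup>2 - a\<^sup>2\<close>, so the umbilic equation is linear in
  \<open>(a + 2 \<epsilon> y\<^sup>2)\<^sup>2\<close>.
\<close>

lemma meridian_equation:
  assumes "b * z^2 = 1 - a * y^2 - \<epsilon> * y^4"
  shows "(a - b) * (a + 2 * \<epsilon> * y^2)^2 = 6 * \<epsilon> * b^2 * z^2 \<longleftrightarrow>
    (2 * a + b) * (a + 2 * \<epsilon> * y^2)^2 = 3 * b * (a^2 + 4 * \<epsilon>)"
proof -
  have "6 * \<epsilon> * b^2 * z^2 = 6 * \<epsilon> * b * (b * z^2)" by (simp add: power2_eq_square)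
  then have "2 * (6 * \<epsilon> * b^2 * z^2 - (a - b) * (a + 2 * \<epsilon> * y^2)^2)
    = 3 * b * (a^2 + 4 * \<epsilon>) - (2 * a + b) * (a + 2 * \<epsilon> * y^2)^2"
    unfolding assms by algebra
  then show ?thesis by auto
qed

lemma factor_gt: "y \<noteq> 0 \<Longrightarrow> a + 2 * \<epsilon> * y^2 > a"
  using eps_pos by simp

lemma meridian_threshold:
  "\<epsilon> \<le> a^2 / 6 * (a / b - 1) \<longleftrightarrow> 3 * b * (a^2 + 4 * \<epsilon>) \<le> (2 * a + b) * a^2"
proof -
  have "\<epsilon> \<le> a^2 / 6 * (a / b - 1) \<longleftrightarrow> 6 * \<epsilon> * b \<le> (a - b) * a^2"
    using b_pos by (simp add: field_simps power2_eq_square)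
  moreover have diff: "(2 * a + b) * a^2 - 3 * b * (a^2 + 4 * \<epsilon>) = 2 * ((a - b) * a^2 - 6 * \<epsilon> * b)"
    by algebra
  have "3 * b * (a^2 + 4 * \<epsilon>) \<le> (2 * a + b) * a^2 \<longleftrightarrow> 0 \<le> 2 * ((a - b) * a^2 - 6 * \<epsilon> * b)"
    unfolding diff[symmetric] by (simp only: diff_ge_0_iff_ge)
  ultimately show ?thesis by (simp add: mult.assoc)
qed

lemma prolate_off_meridian:
  assumes "a > b" shows "\<not> (z = 0 \<and> x \<noteq> 0 \<and> y \<noteq> 0 \<and>
      (6 * \<epsilon> * x^2 - (b - a)) * (y^2 * (a + 2 * \<epsilon> * y^2)^2)
      + (6 * \<epsilon> * y^2 - (b - a)) * (x^2 * (a + 2 * \<epsilon> * x^2)^2) = 0)"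
    and "\<not> (x \<noteq> 0 \<and> y \<noteq> 0 \<and> z \<noteq> 0 \<and> 6 * \<epsilon> * x^2 = b - a \<and> 6 * \<epsilon> * y^2 = b - a)"
proof -
  have pos: "6 * \<epsilon> * t^2 - (b - a) > 0" for t
    using assms eps_pos by (smt (verit) mult_nonneg_nonneg zero_le_power2)
  have sq: "t \<noteq> 0 \<Longrightarrow> t^2 * (a + 2 * \<epsilon> * t^2)^2 > 0" for t
    using factor_pos[of t] by simp
  have "x \<noteq> 0 \<Longrightarrow> y \<noteq> 0 \<Longrightarrow> (6 * \<epsilon> * x^2 - (b - a)) * (y^2 * (a + 2 * \<epsilon> * y^2)^2)
      + (6 * \<epsilon> * y^2 - (b - a)) * (x^2 * (a + 2 * \<epsilon> * x^2)^2) > 0"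
    by (intro add_pos_pos mult_pos_pos[OF pos sq])
  then show "\<not> (z = 0 \<and> x \<noteq> 0 \<and> y \<noteq> 0 \<and>
      (6 * \<epsilon> * x^2 - (b - a)) * (y^2 * (a + 2 * \<epsilon> * y^2)^2)
      + (6 * \<epsilon> * y^2 - (b - a)) * (x^2 * (a + 2 * \<epsilon> * x^2)^2) = 0)" by auto
  show "\<not> (x \<noteq> 0 \<and> y \<noteq> 0 \<and> z \<noteq> 0 \<and> 6 * \<epsilon> * x^2 = b - a \<and> 6 * \<epsilon> * y^2 = b - a)"
    using pos[of x] by auto
qed

lemma umbilics_prolate_small:
  assumes "a > b" "\<epsilon> \<le> a^2 / 6 * (a / b - 1)"
  shows "umbilic_points S = poles"
proof (rule set_eq_vectorI)
  fix x y z
  have no: "(2 * a + b) * (a + 2 * \<epsilon> * t^2)^2 \<noteq> 3 * b * (a^2 + 4 * \<epsilon>)" if "t \<noteq> 0" for t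
  proof -
    have "a^2 < (a + 2 * \<epsilon> * t^2)^2"
      using factor_gt[OF that] a_pos by (intro power_strict_mono) auto
    then have "(2 * a + b) * a^2 < (2 * a + b) * (a + 2 * \<epsilon> * t^2)^2"
      using a_pos b_pos by simp
    then show ?thesis using assms(2) unfolding meridian_threshold by linarith
  qed
  have "a * x^2 + \<epsilon> * x^4 + a * y^2 + \<epsilon> * y^4 + b * z^2 = 1 \<and> umbilic_condition x y z \<longleftrightarrow>
      x = 0 \<and> y = 0 \<and> b * z^2 = 1"
    unfolding umbilic_condition_def
    using prolate_off_meridian(1)[OF assms(1), of z x y] prolate_off_meridian(2)[OF assms(1), of x y z] no[of x] no[of y]
      meridian_equation[of z x] meridian_equation[of z y] by auto
  then show "vector [x, y, z] \<in> umbilic_points S \<longleftrightarrow> vector [x, y, z] \<in> poles"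
    using assms(1) by (simp only: umbilic_points_iff vector_in_box3 pole_iff singleton_iff)
qed

text \<open>
  Above the threshold the value \<open>w = a + 2 \<epsilon> \<rho>\<^sup>2\<close> solving the meridian equation exceeds \<open>a\<close>, which is
  what a real \<open>\<rho> \<noteq> 0\<close> requires.
\<close>

lemma meridian_umbilics:
  fixes \<rho> \<zeta> :: real
  assumes "a > b" and large: "\<epsilon> > a^2 / 6 * (a / b - 1)"
    and rho: "\<rho> = sqrt ((- a + sqrt (3 * b * inverse (2 * a + b) * (a^2 + 4 * \<epsilon>))) / (2 * \<epsilon>))"
    and zeta: "\<zeta> = sqrt ((a - b) * (a^2 + 4 * \<epsilon>) / (2 * b * \<epsilon> * (2 * a + b)))"
  shows "\<rho> > 0" "\<zeta> > 0"
    and "a * t^2 + \<epsilon> * t^4 + b * z^2 = 1 \<and> (a - b) * (a + 2 * \<epsilon> * t^2)^2 = 6 * \<epsilon> * b^2 * z^2 \<longleftrightarrow>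
      t^2 = \<rho>^2 \<and> z^2 = \<zeta>^2"
proof -
  \<comment> \<open>\<open>w\<close> will be the common value of \<open>a + 2 \<epsilon> t\<^sup>2\<close> at the umbilics of the meridian.\<close>
  define D q where "D = 2 * a + b" and "q = a^2 + 4 * \<epsilon>"
  have D: "D > 0" and q: "q > 0" using a_pos b_pos eps_pos by (simp_all add: D_def q_def add_pos_pos)
  define w where "w = sqrt (3 * b * inverse D * q)"
  have "D * w^2 = D * (3 * b * inverse D * q)" using D q b_pos by (simp add: w_def)
  then have w2: "D * w^2 = 3 * b * q" using D by (simp add: field_simps)
  have w0: "w \<ge> 0" using D q b_pos by (simp add: w_def)
  have "\<not> 3 * b * q \<le> D * a^2"
    using large unfolding D_def q_def meridian_threshold[symmetric] by (simp only: not_le)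
  then have "D * a^2 < D * w^2" unfolding w2 by (simp only: not_le)
  then have "a^2 < w^2" using D by simp
  then have wa: "w > a" using w0 by (rule power2_less_imp_less)
  have r2: "\<rho>^2 = (w - a) / (2 * \<epsilon>)" and rp: "\<rho> > 0"
    using wa eps_pos by (simp_all add: rho w_def D_def q_def)
  have "\<zeta>^2 = (a - b) * q / (2 * b * \<epsilon> * D)" and zp: "\<zeta> > 0"
    using assms(1) D q b_pos eps_pos by (simp_all add: zeta D_def[symmetric] q_def[symmetric])
  then have z2: "2 * b * \<epsilon> * D * \<zeta>^2 = (a - b) * q" using D b_pos eps_pos by simp
  have aw: "a + 2 * \<epsilon> * \<rho>^2 = w" using eps_pos by (simp add: r2)
  show "\<rho> > 0" "\<zeta> > 0" by fact+
  show "a * t^2 + \<epsilon> * t^4 + b * z^2 = 1 \<and> (a - b) * (a + 2 * \<epsilon> * t^2)^2 = 6 * \<epsilon> * b^2 * z^2 \<longleftrightarrow>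
      t^2 = \<rho>^2 \<and> z^2 = \<zeta>^2" (is "?L \<longleftrightarrow> ?R")
  proof
    assume L: ?L
    then have "D * (a + 2 * \<epsilon> * t^2)^2 = D * w^2"
      using meridian_equation[of z t] w2 by (simp add: D_def q_def)
    then have "(a + 2 * \<epsilon> * t^2)^2 = w^2" using D by simp
    then have tw: "a + 2 * \<epsilon> * t^2 = w"
      using w0 factor_pos[of t] by (metis less_imp_le power2_eq_imp_eq)
    then have "t^2 = \<rho>^2" using eps_pos by (simp add: r2 field_simps)
    moreover have "z^2 = \<zeta>^2"
    proof -
      have "(6 * \<epsilon> * b^2 * D) * z^2 = (a - b) * (D * w^2)"
        using L unfolding tw by (simp add: algebra_simps)
      also have "\<dots> = (6 * \<epsilon> * b^2 * D) * \<zeta>^2"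
        unfolding w2 using z2 by algebra
      finally show ?thesis using D eps_pos b_pos by simp
    qed
    ultimately show ?R by blast
  next
    assume R: ?R
    then have tw: "a + 2 * \<epsilon> * t^2 = w" using aw by simp
    have z2': "2 * b * \<epsilon> * D * z^2 = (a - b) * q" using R z2 by simp
    have "D * ((a - b) * w^2) = D * (6 * \<epsilon> * b^2 * z^2)"
      using w2 z2' by algebra
    then have 1: "(a - b) * (a + 2 * \<epsilon> * t^2)^2 = 6 * \<epsilon> * b^2 * z^2"
      using D unfolding tw by simp
    have "4 * \<epsilon> * D * (a * t^2 + \<epsilon> * t^4 + b * z^2) = D * w^2 - D * a^2 + 2 * (2 * b * \<epsilon> * D * z^2)"
      unfolding tw[symmetric] by algebra
    also have "\<dots> = 4 * \<epsilon> * D * 1"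
      unfolding w2 z2' unfolding D_def q_def by algebra
    finally have "a * t^2 + \<epsilon> * t^4 + b * z^2 = 1"
      using D eps_pos by simp
    with 1 show ?L by blast
  qed
qed

lemma umbilics_prolate_large:
  fixes \<rho> \<zeta> :: real
  assumes "a > b" and large: "\<epsilon> > a^2 / 6 * (a / b - 1)"
    and rho: "\<rho> = sqrt ((- a + sqrt (3 * b * inverse (2 * a + b) * (a^2 + 4 * \<epsilon>))) / (2 * \<epsilon>))"
    and zeta: "\<zeta> = sqrt ((a - b) * (a^2 + 4 * \<epsilon>) / (2 * b * \<epsilon> * (2 * a + b)))"
  shows "umbilic_points S = poles \<union> box3 {0} {\<rho>, -\<rho>} {\<zeta>, -\<zeta>} \<union> box3 {\<rho>, -\<rho>} {0} {\<zeta>, -\<zeta>}"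
    and "card (umbilic_points S) = 10"
proof -
  note m = meridian_umbilics[OF assms]
  show *: "umbilic_points S = poles \<union> box3 {0} {\<rho>, -\<rho>} {\<zeta>, -\<zeta>} \<union> box3 {\<rho>, -\<rho>} {0} {\<zeta>, -\<zeta>}"
  proof (rule set_eq_vectorI)
    fix x y z
    have nz: "t^2 = \<rho>^2 \<Longrightarrow> t \<noteq> 0" "z^2 = \<zeta>^2 \<Longrightarrow> z \<noteq> 0" for t using m(1,2) by auto
    have "a * x^2 + \<epsilon> * x^4 + a * y^2 + \<epsilon> * y^4 + b * z^2 = 1 \<and> umbilic_condition x y z \<longleftrightarrow>
      x = 0 \<and> y = 0 \<and> b * z^2 = 1 \<or> x = 0 \<and> y^2 = \<rho>^2 \<and> z^2 = \<zeta>^2 \<or> x^2 = \<rho>^2 \<and> y = 0 \<and> z^2 = \<zeta>^2"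
      unfolding umbilic_condition_def
      using prolate_off_meridian(1)[OF assms(1), of z x y] prolate_off_meridian(2)[OF assms(1), of x y z]
        nz(1)[of x] nz(1)[of y] nz(2) m(3)[of x z] m(3)[of y z]
      by (cases "x = 0"; cases "y = 0") auto
    then show "vector [x, y, z] \<in> umbilic_points S \<longleftrightarrow>
        vector [x, y, z] \<in> poles \<union> box3 {0} {\<rho>, -\<rho>} {\<zeta>, -\<zeta>} \<union> box3 {\<rho>, -\<rho>} {0} {\<zeta>, -\<zeta>}"
      using assms(1) m(1,2)
      by (simp only: umbilic_points_iff Un_iff vector_in_box3 pole_iff singleton_iff
          mem_pm_iff less_imp_le) auto
  qed
  have "poles \<inter> box3 {0} {\<rho>, -\<rho>} {\<zeta>, -\<zeta>} = {}"
    "(poles \<union> box3 {0} {\<rho>, -\<rho>} {\<zeta>, -\<zeta>}) \<inter> box3 {\<rho>, -\<rho>} {0} {\<zeta>, -\<zeta>} = {}"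
    using m(1) by (auto simp: box3_def)
  then show "card (umbilic_points S) = 10"
    unfolding * using m(1,2) by (simp add: card_Un_disjoint finite_box3 card_poles) (simp add: card_box3 card_pm)
qed

lemma oblate_off_meridian:
  assumes "a < b" "z \<noteq> 0"
  shows "(a - b) * (a + 2 * \<epsilon> * t^2)^2 \<noteq> 6 * \<epsilon> * b^2 * z^2"
proof -
  have "(a - b) * (a + 2 * \<epsilon> * t^2)^2 < 0"
    using assms factor_pos[of t] by (simp add: mult_neg_pos)
  moreover have "6 * \<epsilon> * b^2 * z^2 > 0" using assms eps_pos b_pos by simp
  ultimately show ?thesis by simp
qed

lemma equator_reduction:
  "equator_form a (2 * a + b) (a + 2 * \<epsilon> * x^2) (a + 2 * \<epsilon> * y^2) =
    2 * \<epsilon> * ((6 * \<epsilon> * x^2 - (b - a)) * (y^2 * (a + 2 * \<epsilon> * y^2)^2)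
      + (6 * \<epsilon> * y^2 - (b - a)) * (x^2 * (a + 2 * \<epsilon> * x^2)^2))"
  unfolding equator_form_def by algebra

lemma equator_on_surface:
  "a * x^2 + \<epsilon> * x^4 + a * y^2 + \<epsilon> * y^4 = 1 \<longleftrightarrow>
    (a + 2 * \<epsilon> * x^2)^2 + (a + 2 * \<epsilon> * y^2)^2 = 2 * (a^2 + 2 * \<epsilon>)"
proof -
  have "(a + 2 * \<epsilon> * x^2)^2 + (a + 2 * \<epsilon> * y^2)^2 - 2 * (a^2 + 2 * \<epsilon>)
      = 4 * \<epsilon> * (a * x^2 + \<epsilon> * x^4 + a * y^2 + \<epsilon> * y^4 - 1)"
    by algebra
  then show ?thesis using eps_pos by auto
qed

lemma oblate_threshold:
  "\<epsilon> < (5 * a + b) * (b - a) / 18 \<longleftrightarrow> 9 * (a^2 + 2 * \<epsilon>) < (2 * a + b)^2"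
  "\<epsilon> > (5 * a + b) * (b - a) / 18 \<longleftrightarrow> 9 * (a^2 + 2 * \<epsilon>) > (2 * a + b)^2"
proof -
  have "9 * (a^2 + 2 * \<epsilon>) - (2 * a + b)^2 = 18 * \<epsilon> - (5 * a + b) * (b - a)" by algebra
  then show "\<epsilon> < (5 * a + b) * (b - a) / 18 \<longleftrightarrow> 9 * (a^2 + 2 * \<epsilon>) < (2 * a + b)^2"
    "\<epsilon> > (5 * a + b) * (b - a) / 18 \<longleftrightarrow> 9 * (a^2 + 2 * \<epsilon>) > (2 * a + b)^2"
    by linarith+
qed

lemma diagonal_surface:
  assumes "6 * \<epsilon> * x^2 = b - a" "6 * \<epsilon> * y^2 = b - a"
  shows "a * x^2 + \<epsilon> * x^4 + a * y^2 + \<epsilon> * y^4 + b * z^2 = 1 \<longleftrightarrow>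
    18 * b * \<epsilon> * z^2 = 5 * a^2 - 4 * a * b - b^2 + 18 * \<epsilon>"
proof -
  have "18 * \<epsilon> * (a * x^2 + \<epsilon> * x^4 + a * y^2 + \<epsilon> * y^4 + b * z^2 - 1) =
      18 * b * \<epsilon> * z^2 - (5 * a^2 - 4 * a * b - b^2 + 18 * \<epsilon>)"
    using assms by algebra
  then show ?thesis using eps_pos by auto
qed

lemma umbilics_oblate_small:
  assumes "a < b" and small: "\<epsilon> < (5 * a + b) * (b - a) / 18"
  shows "umbilic_points S = poles"
proof (rule set_eq_vectorI)
  fix x y z
  have no_equator: "(6 * \<epsilon> * x^2 - (b - a)) * (y^2 * (a + 2 * \<epsilon> * y^2)^2)
      + (6 * \<epsilon> * y^2 - (b - a)) * (x^2 * (a + 2 * \<epsilon> * x^2)^2) \<noteq> 0"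
    if "x \<noteq> 0" "y \<noteq> 0" "a * x^2 + \<epsilon> * x^4 + a * y^2 + \<epsilon> * y^4 = 1"
    using equator_no_solution[OF a_pos _ factor_gt[OF that(1)] factor_gt[OF that(2)],
        of "2 * a + b" "a^2 + 2 * \<epsilon>"] that(3) assms(1) small
    unfolding equator_on_surface oblate_threshold equator_reduction by auto
  have no_diagonal: False if "6 * \<epsilon> * x^2 = b - a" "6 * \<epsilon> * y^2 = b - a"
    "a * x^2 + \<epsilon> * x^4 + a * y^2 + \<epsilon> * y^4 + b * z^2 = 1"
  proof -
    have "5 * a^2 - 4 * a * b - b^2 + 18 * \<epsilon> = 18 * \<epsilon> - (5 * a + b) * (b - a)" by algebra
    then have "18 * b * \<epsilon> * z^2 < 0"
      using that(3) small unfolding diagonal_surface[OF that(1,2)] by linarith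
    moreover have "18 * b * \<epsilon> * z^2 \<ge> 0" using b_pos eps_pos by simp
    ultimately show False by linarith
  qed
  have "a * x^2 + \<epsilon> * x^4 + a * y^2 + \<epsilon> * y^4 + b * z^2 = 1 \<and> umbilic_condition x y z \<longleftrightarrow>
      x = 0 \<and> y = 0 \<and> b * z^2 = 1"
    unfolding umbilic_condition_def
    using no_equator no_diagonal oblate_off_meridian[OF assms(1), of z x]
      oblate_off_meridian[OF assms(1), of z y] by auto
  then show "vector [x, y, z] \<in> umbilic_points S \<longleftrightarrow> vector [x, y, z] \<in> poles"
    using assms(1) by (simp only: umbilic_points_iff vector_in_box3 pole_iff singleton_iff)
qed

text \<open>
  The four families are the poles, the eight points off the coordinate planes, and eight equatorial
  points that come from the two orderings of the unique pair \<open>{u, v}\<close>.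
\<close>

lemma umbilics_oblate_large:
  assumes "a < b" and large: "\<epsilon> > (5 * a + b) * (b - a) / 18"
  defines "\<eta> \<equiv> sqrt ((b - a) / (6 * \<epsilon>))"
    and "\<omega> \<equiv> sqrt ((5 * a^2 - 4 * a * b - b^2 + 18 * \<epsilon>) / (18 * b * \<epsilon>))"
  shows "poles \<union> box3 {\<eta>, -\<eta>} {\<eta>, -\<eta>} {\<omega>, -\<omega>} \<subseteq> umbilic_points S"
    and "card (umbilic_points S) = 18"
proof -
  have \<eta>: "\<eta> > 0" "6 * \<epsilon> * \<eta>^2 = b - a" using assms(1) eps_pos by (simp_all add: \<eta>_def)
  have pos: "5 * a^2 - 4 * a * b - b^2 + 18 * \<epsilon> > 0"
  proof -
    have "5 * a^2 - 4 * a * b - b^2 + 18 * \<epsilon> = 18 * \<epsilon> - (5 * a + b) * (b - a)" by algebra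
    then show ?thesis using large by linarith
  qed
  then have \<omega>: "\<omega> > 0" "18 * b * \<epsilon> * \<omega>^2 = 5 * a^2 - 4 * a * b - b^2 + 18 * \<epsilon>"
    using b_pos eps_pos by (simp_all add: \<omega>_def)
  have \<eta>_iff: "6 * \<epsilon> * t^2 = b - a \<longleftrightarrow> t^2 = \<eta>^2" for t
    unfolding \<eta>(2)[symmetric] using eps_pos by simp
  have \<omega>_iff: "18 * b * \<epsilon> * t^2 = 5 * a^2 - 4 * a * b - b^2 + 18 * \<epsilon> \<longleftrightarrow> t^2 = \<omega>^2" for t
    unfolding \<omega>(2)[symmetric] using eps_pos b_pos by simp
  have e: "2 * a + b > 3 * a" using assms(1) by simp
  have big: "(2 * a + b)^2 < 9 * (a^2 + 2 * \<epsilon>)"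
    using large unfolding oblate_threshold .
  obtain u v where uv: "v > a" "u > v" "u^2 + v^2 = 2 * (a^2 + 2 * \<epsilon>)" "equator_form a (2 * a + b) u v = 0"
    by (rule equator_solution_exists[OF a_pos e _ big]) (use eps_pos in simp_all)
  define x0 y0 where "x0 = sqrt ((u - a) / (2 * \<epsilon>))" and "y0 = sqrt ((v - a) / (2 * \<epsilon>))"
  have xy0: "x0 > 0" "y0 > 0" and ux: "a + 2 * \<epsilon> * x0^2 = u" and vy: "a + 2 * \<epsilon> * y0^2 = v"
    using uv(1,2) eps_pos by (simp_all add: x0_def y0_def)
  have "x0 \<noteq> y0" using ux vy uv(2) by auto
  have conv: "a + 2 * \<epsilon> * t^2 = u \<longleftrightarrow> t^2 = x0^2" "a + 2 * \<epsilon> * t^2 = v \<longleftrightarrow> t^2 = y0^2" for t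
    using eps_pos by (auto simp flip: ux vy)
  have equator: "a * x^2 + \<epsilon> * x^4 + a * y^2 + \<epsilon> * y^4 = 1 \<and>
      (6 * \<epsilon> * x^2 - (b - a)) * (y^2 * (a + 2 * \<epsilon> * y^2)^2)
      + (6 * \<epsilon> * y^2 - (b - a)) * (x^2 * (a + 2 * \<epsilon> * x^2)^2) = 0 \<longleftrightarrow>
      x^2 = x0^2 \<and> y^2 = y0^2 \<or> x^2 = y0^2 \<and> y^2 = x0^2" (is "?L \<longleftrightarrow> ?R")
    if "x \<noteq> 0" "y \<noteq> 0" for x y
  proof -
    define U V where "U = a + 2 * \<epsilon> * x^2" and "V = a + 2 * \<epsilon> * y^2"
    have "?L \<longleftrightarrow> U^2 + V^2 = 2 * (a^2 + 2 * \<epsilon>) \<and> equator_form a (2 * a + b) U V = 0"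
      unfolding equator_on_surface U_def V_def equator_reduction using eps_pos by simp
    also have "\<dots> \<longleftrightarrow> U = u \<and> V = v \<or> U = v \<and> V = u"
    proof
      assume "U^2 + V^2 = 2 * (a^2 + 2 * \<epsilon>) \<and> equator_form a (2 * a + b) U V = 0"
      then show "U = u \<and> V = v \<or> U = v \<and> V = u"
        using equator_solutions_unique[OF a_pos e, of U V "a^2 + 2 * \<epsilon>" u v] uv
          factor_gt that by (auto simp: U_def V_def)
    next
      have "equator_form a (2 * a + b) v u = 0" "v^2 + u^2 = 2 * (a^2 + 2 * \<epsilon>)"
        using uv(3,4) by (simp_all add: equator_form_def)
      then show "U = u \<and> V = v \<or> U = v \<and> V = u \<Longrightarrow>
          U^2 + V^2 = 2 * (a^2 + 2 * \<epsilon>) \<and> equator_form a (2 * a + b) U V = 0"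
        using uv(3,4) by auto
    qed
    also have "\<dots> \<longleftrightarrow> ?R" unfolding U_def V_def conv ..
    finally show ?thesis .
  qed
  have *: "umbilic_points S = poles \<union> box3 {\<eta>, -\<eta>} {\<eta>, -\<eta>} {\<omega>, -\<omega>}
      \<union> box3 {x0, -x0} {y0, -y0} {0} \<union> box3 {y0, -y0} {x0, -x0} {0}"
  proof (rule set_eq_vectorI)
    fix x y z
    have nz: "t^2 = x0^2 \<Longrightarrow> t \<noteq> 0" "t^2 = y0^2 \<Longrightarrow> t \<noteq> 0" "t^2 = \<eta>^2 \<Longrightarrow> t \<noteq> 0" "t^2 = \<omega>^2 \<Longrightarrow> t \<noteq> 0" for t
      using xy0 \<eta>(1) \<omega>(1) by auto
    have diagonal: "a * x^2 + \<epsilon> * x^4 + a * y^2 + \<epsilon> * y^4 + b * z^2 = 1 \<longleftrightarrow> z^2 = \<omega>^2"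
      if "x^2 = \<eta>^2" "y^2 = \<eta>^2"
      using diagonal_surface[of x y z] that unfolding \<eta>_iff \<omega>_iff by simp
    have "a * x^2 + \<epsilon> * x^4 + a * y^2 + \<epsilon> * y^4 + b * z^2 = 1 \<and> umbilic_condition x y z \<longleftrightarrow>
      x = 0 \<and> y = 0 \<and> b * z^2 = 1 \<or> x^2 = \<eta>^2 \<and> y^2 = \<eta>^2 \<and> z^2 = \<omega>^2
      \<or> x^2 = x0^2 \<and> y^2 = y0^2 \<and> z = 0 \<or> x^2 = y0^2 \<and> y^2 = x0^2 \<and> z = 0"
      unfolding umbilic_condition_def \<eta>_iff
      using oblate_off_meridian[OF assms(1), of z x] oblate_off_meridian[OF assms(1), of z y]
        equator[of x y] diagonal nz[of x] nz[of y] nz(4)[of z]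
      by (cases "x = 0"; cases "y = 0"; cases "z = 0") auto
    then show "vector [x, y, z] \<in> umbilic_points S \<longleftrightarrow>
        vector [x, y, z] \<in> poles \<union> box3 {\<eta>, -\<eta>} {\<eta>, -\<eta>} {\<omega>, -\<omega>}
          \<union> box3 {x0, -x0} {y0, -y0} {0} \<union> box3 {y0, -y0} {x0, -x0} {0}"
      using assms(1) \<eta>(1) \<omega>(1) xy0
      by (simp only: umbilic_points_iff Un_iff vector_in_box3 pole_iff singleton_iff
          mem_pm_iff less_imp_le) auto
  qed
  show "poles \<union> box3 {\<eta>, -\<eta>} {\<eta>, -\<eta>} {\<omega>, -\<omega>} \<subseteq> umbilic_points S"
    unfolding * by blast
  have "poles \<inter> box3 {\<eta>, -\<eta>} {\<eta>, -\<eta>} {\<omega>, -\<omega>} = {}"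
    "(poles \<union> box3 {\<eta>, -\<eta>} {\<eta>, -\<eta>} {\<omega>, -\<omega>}) \<inter> box3 {x0, -x0} {y0, -y0} {0} = {}"
    "(poles \<union> box3 {\<eta>, -\<eta>} {\<eta>, -\<eta>} {\<omega>, -\<omega>} \<union> box3 {x0, -x0} {y0, -y0} {0})
      \<inter> box3 {y0, -y0} {x0, -x0} {0} = {}"
  proof -
    have "{0} \<inter> {t, -t} = {}" "{t, -t} \<inter> {0} = {}" if "t > 0" for t :: real using that by auto
    moreover have "{x0, -x0} \<inter> {y0, -y0} = {}" using xy0 \<open>x0 \<noteq> y0\<close> by auto
    ultimately show "poles \<inter> box3 {\<eta>, -\<eta>} {\<eta>, -\<eta>} {\<omega>, -\<omega>} = {}"
      "(poles \<union> box3 {\<eta>, -\<eta>} {\<eta>, -\<eta>} {\<omega>, -\<omega>}) \<inter> box3 {x0, -x0} {y0, -y0} {0} = {}"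
      "(poles \<union> box3 {\<eta>, -\<eta>} {\<eta>, -\<eta>} {\<omega>, -\<omega>} \<union> box3 {x0, -x0} {y0, -y0} {0})
        \<inter> box3 {y0, -y0} {x0, -x0} {0} = {}"
      unfolding Int_Un_distrib2 Un_empty using \<eta>(1) \<omega>(1) xy0 by (intro conjI box3_disjoint; metis)+
  qed
  then show "card (umbilic_points S) = 18"
    unfolding * using \<eta>(1) \<omega>(1) xy0
    by (simp add: card_Un_disjoint finite_box3 card_poles) (simp add: card_box3 card_pm)
qed

end

lemma sign_families:
  "{f s | s. s \<in> {1, -1 :: real}} = {f 1, f (-1)}"
  "{g s t | s t. s \<in> {1, -1 :: real} \<and> t \<in> {1, -1 :: real}} = {g 1 1, g 1 (-1), g (-1) 1, g (-1) (-1)}"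
  "{h r s t | r s t. r \<in> {1, -1 :: real} \<and> s \<in> {1, -1 :: real} \<and> t \<in> {1, -1 :: real}} =
    {h 1 1 1, h 1 1 (-1), h 1 (-1) 1, h 1 (-1) (-1), h (-1) 1 1, h (-1) 1 (-1), h (-1) (-1) 1, h (-1) (-1) (-1)}"
  by blast+

lemma sign_orbits_eq_box3:
  fixes \<alpha> \<beta> \<gamma> :: real
  shows "{vector [0, 0, s * \<gamma>] | s. s \<in> {1, -1}} = box3 {0} {0} {\<gamma>, -\<gamma>}"
    and "{vector [0, s * \<beta>, t * \<gamma>] | s t. s \<in> {1, -1} \<and> t \<in> {1, -1}} = box3 {0} {\<beta>, -\<beta>} {\<gamma>, -\<gamma>}"
    and "{vector [s * \<alpha>, 0, t * \<gamma>] | s t. s \<in> {1, -1} \<and> t \<in> {1, -1}} = box3 {\<alpha>, -\<alpha>} {0} {\<gamma>, -\<gamma>}"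
    and "{vector [s * \<alpha>, t * \<beta>, r * \<gamma>] | r s t. r \<in> {1, -1} \<and> s \<in> {1, -1} \<and> t \<in> {1, -1}} =
      box3 {\<alpha>, -\<alpha>} {\<beta>, -\<beta>} {\<gamma>, -\<gamma>}"
  unfolding sign_families box3_eq_image by auto

theorem theorem3p1:
  fixes a b \<epsilon> \<rho> \<zeta> :: real and M :: "(real^3) set"
  assumes "a > 0" and "b > 0" and "\<epsilon> > 0"
    and M: "M = {p. a * (p$1)^2 + \<epsilon> * (p$1)^4 + a * (p$2)^2 + \<epsilon> * (p$2)^4 + b * (p$3)^2 = 1}"
    and rho: "\<rho> = sqrt ((- a + sqrt (3 * b * inverse (2 * a + b) * (a^2 + 4 * \<epsilon>))) / (2 * \<epsilon>))"
    and zeta: "\<zeta> = sqrt ((a - b) * (a^2 + 4 * \<epsilon>) / (2 * b * \<epsilon> * (2 * a + b)))"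
  shows
    "(a > b \<longrightarrow>
       (\<epsilon> \<le> a^2 / 6 * (a / b - 1) \<longrightarrow>
          card (umbilic_points M) = 2 \<and>
          umbilic_points M = {vector [0, 0, s * sqrt (1 / b)] | s. s \<in> {1, -1}} \<and>
          (\<forall>p \<in> umbilic_points M. has_umbilic_index M p 1)) \<and>
       (\<epsilon> > a^2 / 6 * (a / b - 1) \<longrightarrow>
          card (umbilic_points M) = 10 \<and>
          umbilic_points M =
            {vector [0, 0, s * sqrt (1 / b)] | s. s \<in> {1, -1}} \<union>
            {vector [0, s * \<rho>, t * \<zeta>] | s t. s \<in> {1, -1} \<and> t \<in> {1, -1}} \<union>
            {vector [s * \<rho>, 0, t * \<zeta>] | s t. s \<in> {1, -1} \<and> t \<in> {1, -1}})) \<and>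
     (a < b \<longrightarrow>
       (\<epsilon> < (5 * a + b) * (b - a) / 18 \<longrightarrow>
          card (umbilic_points M) = 2 \<and>
          umbilic_points M = {vector [0, 0, s * sqrt (1 / b)] | s. s \<in> {1, -1}} \<and>
          (\<forall>p \<in> umbilic_points M. has_umbilic_index M p 1)) \<and>
       (\<epsilon> > (5 * a + b) * (b - a) / 18 \<longrightarrow>
          card (umbilic_points M) = 18 \<and>
          {vector [0, 0, s * sqrt (1 / b)] | s. s \<in> {1, -1}} \<union>
          {vector [s * sqrt ((b - a) / (6 * \<epsilon>)), t * sqrt ((b - a) / (6 * \<epsilon>)),
                   r * sqrt ((5 * a^2 - 4 * a * b - b^2 + 18 * \<epsilon>) / (18 * b * \<epsilon>))]
            | r s t. r \<in> {1, -1} \<and> s \<in> {1, -1} \<and> t \<in> {1, -1}}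
          \<subseteq> umbilic_points M))"
proof -
  interpret quartic_spheroid a b \<epsilon> using assms(1-3) by unfold_locales
  have MS: "M = S" unfolding M using surface_iff by blast
  have isolated: "p isolated_in umbilic_points S" if "umbilic_points S = poles" "p \<in> umbilic_points S" for p
    using that by (intro finite_imp_isolated) (simp_all add: finite_box3)
  have prolate_index: "has_umbilic_index S p 1"
    if "a > b" "\<epsilon> \<le> a^2 / 6 * (a / b - 1)" "p \<in> umbilic_points S" for p
    using pole_index_prolate[of p] poles_on_surface[of p] umbilics_prolate_small[OF that(1,2)]
      isolated[of p] that by simp
  have oblate_index: "has_umbilic_index S p 1"
    if "a < b" "\<epsilon> < (5 * a + b) * (b - a) / 18" "p \<in> umbilic_points S" for p
    using pole_index_oblate[of p] poles_on_surface[of p] umbilics_oblate_small[OF that(1,2)]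
      isolated[of p] that by simp
  show ?thesis
    unfolding MS sign_orbits_eq_box3
    using umbilics_prolate_small card_poles prolate_index umbilics_prolate_large[OF _ _ rho zeta]
      umbilics_oblate_small oblate_index umbilics_oblate_large
    by simp
qed

end
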